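(* Assume that the initial data $(u_0,\rho_0)$ is subsonic, i.e. $u_0^2<\gamma\rho_0^{\gamma-1}$, and that the external force $\bar f\in C^\infty([L_0,L_1])$ satisfies $$\bar f<0\ \text{on } [L_0,0),\qquad \bar f(0)=0,\qquad \bar f>0\ \text{on } (0,L_1],$$ $$\int_{L_0}^{0}\bar f(\tau)\,d\tau=\frac{\gamma+1}{2(\gamma-1)}\gamma^{\frac{2}{\gamma+1}}J^{\frac{2(\gamma-1)}{\gamma+1}}-B_0 ,$$ and, for some nonnegative integer $m$, $$\bar f'(0)=\bar f''(0)=\cdots=\bar f^{(4m)}(0)=0,\qquad \bar f^{(4m+1)}(0)>0 .$$ Then the problem $$\begin{cases}(\bar\rho\bar u)'(x_1)=0, & x_1\in[L_0,L_1],\\ \bar\rho\bar u\bar u'+\frac{d}{dx_1}P(\bar\rho)=\bar\rho\bar f(x_1), & x_1\in[L_0,L_1],\\ \bar\rho(L_0)=\rho_0,\quad \bar u(L_0)=u_0\end{cases}$$ has a unique smooth accelerating transonic solution $(\bar\rho,\bar u)\in C^\infty([L_0,L_1])$ which is subsonic in $[L_0,0)$, supersonic in $(0,L_1]$, with a sonic state at $x_1=0$. The velocity can be represented as $\bar u(x_1)=c_*+x_1^{2m+1}y(x_1)$ with a positive smooth function $y\in C^\infty([L_0,L_1])$, and $$\bar u'(0)=\bar u''(0)=\cdots=\bar u^{(2m)}(0)=0,$$ $$\bar u^{(2m+1)}(0)=(2m+1)!\,y(0)=(2m+1)!\sqrt{\frac{2\bar f^{(4m+1)}(0)}{(\gamma+1)(4m+2)!}}>0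 .$$ (For $m=0$ the conditions on derivatives of orders $1,\dots,4m$ and $1,\dots,2m$ are empty.)
   Context: Here $\gamma>1$, $P(\rho)=\rho^\gamma$, $L_0<0<L_1$, $\rho_0>0$, $u_0>0$, $J=\rho_0u_0$, $B_0=\frac12u_0^2+\frac{\gamma}{\gamma-1}\rho_0^{\gamma-1}$, and $c_*=\gamma^{\frac1{\gamma+1}}J^{\frac{\gamma-1}{\gamma+1}}$ is the sonic speed. The sound speed is $c(\rho)=\sqrt{\gamma\rho^{\gamma-1}}$; a state $(u,\rho)$ with $u,\rho>0$ is subsonic, sonic or supersonic if $u^2<c^2(\rho)$, $u^2=c^2(\rho)$ or $u^2>c^2(\rho)$ respectively. Accelerating means that $\bar u$ is increasing. *)

theory Defs
  imports "HOL-Analysis.Analysis"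
begin

text \<open>Derivatives are taken within \<open>S\<close>, so that at an endpoint of a compact interval they are the
  one-sided ones and only the values on \<open>S\<close> matter. At interior points they are the ordinary
  derivatives.\<close>

definition deriv_within :: "real set \<Rightarrow> (real \<Rightarrow> real) \<Rightarrow> real \<Rightarrow> real" where
  "deriv_within S f = (\<lambda>x. vector_derivative f (at x within S))"

definition nth_deriv_within :: "real set \<Rightarrow> nat \<Rightarrow> (real \<Rightarrow> real) \<Rightarrow> real \<Rightarrow> real" where
  "nth_deriv_within S n f = (deriv_within S ^^ n) f"

definition smooth_on :: "real set \<Rightarrow> (real \<Rightarrow> real) \<Rightarrow> bool" where
  "smooth_on S f \<longleftrightarrow> (\<forall>n. nth_deriv_within S n f differentiable_on S)"

definition pressure :: "real \<Rightarrow> real \<Rightarrow> real" where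
  "pressure \<gamma> \<rho> = \<rho> powr \<gamma>"

definition sound_speed :: "real \<Rightarrow> real \<Rightarrow> real" where
  "sound_speed \<gamma> \<rho> = sqrt (\<gamma> * \<rho> powr (\<gamma> - 1))"

definition subsonic :: "real \<Rightarrow> real \<Rightarrow> real \<Rightarrow> bool" where
  "subsonic \<gamma> u \<rho> \<longleftrightarrow> u > 0 \<and> \<rho> > 0 \<and> u\<^sup>2 < (sound_speed \<gamma> \<rho>)\<^sup>2"

definition sonic :: "real \<Rightarrow> real \<Rightarrow> real \<Rightarrow> bool" where
  "sonic \<gamma> u \<rho> \<longleftrightarrow> u > 0 \<and> \<rho> > 0 \<and> u\<^sup>2 = (sound_speed \<gamma> \<rho>)\<^sup>2"

definition supersonic :: "real \<Rightarrow> real \<Rightarrow> real \<Rightarrow> bool" where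
  "supersonic \<gamma> u \<rho> \<longleftrightarrow> u > 0 \<and> \<rho> > 0 \<and> u\<^sup>2 > (sound_speed \<gamma> \<rho>)\<^sup>2"

definition sonic_speed :: "real \<Rightarrow> real \<Rightarrow> real" where
  "sonic_speed \<gamma> J = \<gamma> powr (1 / (\<gamma> + 1)) * J powr ((\<gamma> - 1) / (\<gamma> + 1))"

text \<open>The condition \<open>\<rho> x > 0\<close> keeps the density in the domain of \<open>P(\<rho>) = \<rho>\<^sup>\<gamma>\<close>; for nonpositive
  arguments \<^const>\<open>powr\<close> has no physical meaning. Positivity of \<open>u\<close> then follows from the
  first equation and the data.\<close>

definition smooth_solution ::
  "real \<Rightarrow> real \<Rightarrow> real \<Rightarrow> real \<Rightarrow> real \<Rightarrow> (real \<Rightarrow> real) \<Rightarrow> (real \<Rightarrow> real) \<Rightarrow> (real \<Rightarrow> real) \<Rightarrow> bool" where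
  "smooth_solution \<gamma> L0 L1 \<rho>0 u0 f \<rho> u \<longleftrightarrow>
     smooth_on {L0..L1} \<rho> \<and> smooth_on {L0..L1} u \<and>
     (\<forall>x\<in>{L0..L1}. \<rho> x > 0) \<and>
     (\<forall>x\<in>{L0..L1}. deriv_within {L0..L1} (\<lambda>t. \<rho> t * u t) x = 0) \<and>
     (\<forall>x\<in>{L0..L1}. \<rho> x * u x * deriv_within {L0..L1} u x
                      + deriv_within {L0..L1} (\<lambda>t. pressure \<gamma> (\<rho> t)) x = \<rho> x * f x) \<and>
     \<rho> L0 = \<rho>0 \<and> u L0 = u0"

text \<open>Accelerating and transonic, where transonic only means that both regimes occur; where the
  flow is subsonic, sonic or supersonic is not prescribed.\<close>

definition accelerating_transonic ::
  "real \<Rightarrow> real \<Rightarrow> real \<Rightarrow> (real \<Rightarrow> real) \<Rightarrow> (real \<Rightarrow> real) \<Rightarrow> bool" where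
  "accelerating_transonic \<gamma> L0 L1 \<rho> u \<longleftrightarrow>
     strict_mono_on {L0..L1} u \<and>
     (\<exists>x\<in>{L0..L1}. subsonic \<gamma> (u x) (\<rho> x)) \<and>
     (\<exists>x\<in>{L0..L1}. supersonic \<gamma> (u x) (\<rho> x))"

end

theory Submission
  imports Defs
begin

text \<open>By the first equation \<open>\<rho> u = J\<close>, so the momentum equation integrates to Bernoulli's law
  \<open>H(u(x)) = B0 + \<integral>f\<close> with \<open>H(u) = u\<^sup>2/2 + \<gamma>/(\<gamma>-1) J\<^bsup>\<gamma>-1\<^esup> u\<^bsup>1-\<gamma>\<^esup>\<close>. The function \<open>H\<close> has its
  minimum, nondegenerate with \<open>H'' = \<gamma>+1\<close>, at the sonic speed \<open>c\<close>, and the integral condition on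
  \<open>f\<close> says that Bernoulli's law is \<open>H(u(x)) - H(c) = F(x)\<close> with \<open>F(x)\<close> the integral of \<open>f\<close> from
  \<open>0\<close> to \<open>x\<close>. Both sides have smooth signed square roots: \<open>H - H(c) = \<Phi>\<^sup>2\<close> with \<open>\<Phi>\<close> a
  diffeomorphism from \<open>(0,\<infinity>)\<close> onto the real line, and \<open>F = g\<^sup>2\<close> with \<open>g(x) = x\<^bsup>2m+1\<^esup> w(x)\<close>, \<open>w > 0\<close>,
  strictly increasing. Hence \<open>\<Phi>(u) = \<plusminus>g\<close> pointwise, for increasing \<open>u\<close> the sign is \<open>+\<close> everywhere,
  and \<open>u = \<Phi>\<^sup>-\<^sup>1 \<circ> g\<close> is the unique accelerating solution.\<close>

section \<open>Smooth functions within a set\<close>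

text \<open>Exactly the sets within which derivatives are unique at every point.\<close>

definition dense_in_itself :: "real set \<Rightarrow> bool" where
  "dense_in_itself S \<longleftrightarrow> (\<forall>x\<in>S. x islimpt S)"

text \<open>The derivative is quantified existentially instead of being fixed as
  \<open>deriv_within S f\<close>, so closure rules can offer an explicit formula as witness and
  proceed by induction on the order.\<close>

fun times_diff_on :: "real set \<Rightarrow> nat \<Rightarrow> (real \<Rightarrow> real) \<Rightarrow> bool" where
  "times_diff_on S 0 f = True"
| "times_diff_on S (Suc n) f =
    (\<exists>f'. (\<forall>x\<in>S. (f has_real_derivative f' x) (at x within S)) \<and> times_diff_on S n f')"

lemma dense_in_itself_open: "open S \<Longrightarrow> dense_in_itself S"
  by (simp add: dense_in_itself_def open_imp_islimpt)

lemma dense_in_itself_Icc: "a < b \<Longrightarrow> dense_in_itself {a..b}"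
  by (simp add: dense_in_itself_def)

lemma deriv_within_eq:
  assumes "dense_in_itself S" "x \<in> S" "(f has_real_derivative d) (at x within S)"
  shows "deriv_within S f x = d"
  unfolding deriv_within_def
  by (rule vector_derivative_within)
    (use assms in \<open>auto simp: dense_in_itself_def trivial_limit_within has_real_derivative_iff_has_vector_derivative\<close>)

lemma has_real_derivative_deriv_within:
  assumes "f differentiable_on S" "x \<in> S"
  shows "(f has_real_derivative deriv_within S f x) (at x within S)"
  using assms
  by (auto simp: deriv_within_def differentiable_on_def vector_derivative_works
      has_real_derivative_iff_has_vector_derivative)

lemma has_real_derivative_cong_on:
  assumes "\<And>x. x \<in> S \<Longrightarrow> f x = g x" "x \<in> S" "(f has_real_derivative d) (at x within S)"
  shows "(g has_real_derivative d) (at x within S)"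
  using assms has_field_derivative_transform_within[of f d x S 1 g] by simp

lemma DERIV_compose_within:
  assumes "(f has_real_derivative D) (at (g x) within T)" "(g has_real_derivative E) (at x within S)"
    "g ` S \<subseteq> T"
  shows "((\<lambda>x. f (g x)) has_real_derivative D * E) (at x within S)"
  using DERIV_image_chain[OF DERIV_subset[OF assms(1,3)] assms(2)] by (simp add: o_def)

lemma nth_deriv_within_0 [simp]: "nth_deriv_within S 0 f = f"
  by (simp add: nth_deriv_within_def)

lemma nth_deriv_within_Suc:
  "nth_deriv_within S (Suc n) f = nth_deriv_within S n (deriv_within S f)"
  by (simp only: nth_deriv_within_def funpow_Suc_right o_def)

lemma times_diff_on_cong:
  assumes "\<And>x. x \<in> S \<Longrightarrow> f x = g x" "times_diff_on S n f"
  shows "times_diff_on S n g"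
proof (cases n)
  case (Suc k)
  then obtain f' where "\<forall>x\<in>S. (f has_real_derivative f' x) (at x within S)" "times_diff_on S k f'"
    using assms(2) by auto
  then show ?thesis
    using has_real_derivative_cong_on[of S f g] assms(1) Suc by auto
qed simp

lemma smooth_on_deriv_within: "smooth_on S f \<Longrightarrow> smooth_on S (deriv_within S f)"
  unfolding smooth_on_def by (metis nth_deriv_within_Suc)

lemma smooth_on_differentiable_on: "smooth_on S f \<Longrightarrow> f differentiable_on S"
  unfolding smooth_on_def by (metis nth_deriv_within_0)

lemma smooth_on_DERIV:
  "smooth_on S f \<Longrightarrow> x \<in> S \<Longrightarrow> (f has_real_derivative deriv_within S f x) (at x within S)"
  by (intro has_real_derivative_deriv_within smooth_on_differentiable_on)

lemma smooth_on_imp_continuous_on: "smooth_on S f \<Longrightarrow> continuous_on S f"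
  by (intro differentiable_imp_continuous_on smooth_on_differentiable_on)

lemma smooth_on_imp_times_diff_on: "smooth_on S f \<Longrightarrow> times_diff_on S n f"
  by (induction n arbitrary: f) (auto intro: smooth_on_DERIV smooth_on_deriv_within)

text \<open>Uniqueness of derivatives within \<open>S\<close> makes any witness \<open>f'\<close>
  agree with \<open>deriv_within S f\<close> on \<open>S\<close>, which turns the existential
  recursion into iterated derivatives. The order drops by one because \<open>smooth_on\<close>
  speaks of differentiability of the \<open>n\<close>-th derivative.\<close>

lemma times_diff_on_imp_differentiable_on:
  assumes "dense_in_itself S" "times_diff_on S (Suc n) f"
  shows "nth_deriv_within S n f differentiable_on S"
  using assms(2)
proof (induction n arbitrary: f)
  case 0
  then show ?case
    by (auto simp: differentiable_on_def real_differentiable_def)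
next
  case (Suc n)
  then obtain f' where f': "\<And>x. x \<in> S \<Longrightarrow> (f has_real_derivative f' x) (at x within S)"
    "times_diff_on S (Suc n) f'"
    by auto
  have "times_diff_on S (Suc n) (deriv_within S f)"
    by (rule times_diff_on_cong[OF _ f'(2)]) (simp add: deriv_within_eq[OF assms(1) _ f'(1)])
  from Suc.IH[OF this] show ?case
    by (simp add: nth_deriv_within_Suc)
qed

lemma smooth_on_iff_times_diff_on:
  "dense_in_itself S \<Longrightarrow> smooth_on S f \<longleftrightarrow> (\<forall>n. times_diff_on S n f)"
  using times_diff_on_imp_differentiable_on smooth_on_imp_times_diff_on smooth_on_def by blast

lemma smooth_on_cong:
  assumes "dense_in_itself S" "\<And>x. x \<in> S \<Longrightarrow> f x = g x" "smooth_on S f"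
  shows "smooth_on S g"
  using assms times_diff_on_cong[of S f g] by (simp add: smooth_on_iff_times_diff_on)

text \<open>Derivatives within \<open>S\<close> see only values on \<open>S\<close>. Smoothness of
  \<open>f\<close> makes each derivative exist, so that uniqueness identifies the two at every
  order.\<close>

lemma nth_deriv_within_cong:
  assumes "dense_in_itself S" "\<And>x. x \<in> S \<Longrightarrow> f x = g x" "smooth_on S f" "x \<in> S"
  shows "nth_deriv_within S n f x = nth_deriv_within S n g x"
  using assms(2,3)
proof (induction n arbitrary: f g)
  case (Suc n)
  have "deriv_within S f x = deriv_within S g x" if "x \<in> S" for x
    using deriv_within_eq[OF assms(1) that has_real_derivative_cong_on[OF Suc.prems(1) that]]
      smooth_on_DERIV[OF Suc.prems(2) that] by simp
  then show ?case
    using Suc.IH[OF _ smooth_on_deriv_within[OF Suc.prems(2)]] by (simp add: nth_deriv_within_Suc)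
qed (use assms(4) in auto)

lemma smooth_on_of_DERIV:
  assumes "dense_in_itself S" "\<And>x. x \<in> S \<Longrightarrow> (f has_real_derivative f' x) (at x within S)"
    "smooth_on S f'"
  shows "smooth_on S f"
  unfolding smooth_on_iff_times_diff_on[OF assms(1)]
proof
  fix n show "times_diff_on S n f"
    using assms(2) smooth_on_imp_times_diff_on[OF assms(3)] by (cases n) (auto intro: exI[of _ f'])
qed

section \<open>Closure of smoothness under algebraic operations, composition and real powers\<close>

text \<open>Serves the product and chain rules, where undifferentiated functions reappear next to
  the derivatives and must be counted at the lower order.\<close>

lemma times_diff_on_Suc: "times_diff_on S (Suc n) f \<Longrightarrow> times_diff_on S n f"
  by (induction n arbitrary: f) auto

lemma times_diff_on_const [simp]: "times_diff_on S n (\<lambda>x. c)"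
  by (induction n arbitrary: c) (auto intro!: exI[of _ "\<lambda>x. 0"])

lemma times_diff_on_ident [simp]: "times_diff_on S n (\<lambda>x. x)"
  by (cases n) (auto intro!: exI[of _ "\<lambda>x. 1"])

lemma times_diff_on_add:
  "times_diff_on S n f \<Longrightarrow> times_diff_on S n g \<Longrightarrow> times_diff_on S n (\<lambda>x. f x + g x)"
proof (induction n arbitrary: f g)
  case (Suc n)
  then obtain f' g' where "\<forall>x\<in>S. (f has_real_derivative f' x) (at x within S)" "times_diff_on S n f'"
    "\<forall>x\<in>S. (g has_real_derivative g' x) (at x within S)" "times_diff_on S n g'" by auto
  with Suc.IH show ?case
    by (auto intro!: exI[of _ "\<lambda>x. f' x + g' x"] DERIV_add)
qed simp

lemma times_diff_on_mult:
  "times_diff_on S n f \<Longrightarrow> times_diff_on S n g \<Longrightarrow> times_diff_on S n (\<lambda>x. f x * g x)"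
proof (induction n arbitrary: f g)
  case (Suc n)
  then obtain f' g' where *: "\<forall>x\<in>S. (f has_real_derivative f' x) (at x within S)" "times_diff_on S n f'"
    "\<forall>x\<in>S. (g has_real_derivative g' x) (at x within S)" "times_diff_on S n g'" by auto
  have "times_diff_on S n (\<lambda>x. f' x * g x + g' x * f x)"
    by (intro times_diff_on_add Suc.IH * times_diff_on_Suc[OF Suc.prems(1)] times_diff_on_Suc[OF Suc.prems(2)])
  moreover have "\<forall>x\<in>S. ((\<lambda>x. f x * g x) has_real_derivative f' x * g x + g' x * f x) (at x within S)"
    using * DERIV_mult by blast
  ultimately show ?case by auto
qed simp

lemma times_diff_on_compose:
  assumes "g ` S \<subseteq> T"
  shows "times_diff_on T n f \<Longrightarrow> times_diff_on S n g \<Longrightarrow> times_diff_on S n (\<lambda>x. f (g x))"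
proof (induction n arbitrary: f)
  case (Suc n)
  then obtain f' g' where *: "\<forall>x\<in>T. (f has_real_derivative f' x) (at x within T)" "times_diff_on T n f'"
    "\<forall>x\<in>S. (g has_real_derivative g' x) (at x within S)" "times_diff_on S n g'" by auto
  have "times_diff_on S n (\<lambda>x. f' (g x) * g' x)"
    by (rule times_diff_on_mult[OF Suc.IH[OF *(2) times_diff_on_Suc[OF Suc.prems(2)]] *(4)])
  moreover have "\<forall>x\<in>S. ((\<lambda>x. f (g x)) has_real_derivative f' (g x) * g' x) (at x within S)"
    using * assms by (auto intro!: DERIV_compose_within[where T = T and g = g])
  ultimately show ?case by auto
qed simp

context
  fixes S :: "real set"
  assumes S: "dense_in_itself S"
begin

lemma smooth_on_const: "smooth_on S (\<lambda>x. c)"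
  and smooth_on_ident: "smooth_on S (\<lambda>x. x)"
  by (simp_all add: smooth_on_iff_times_diff_on[OF S])

lemma smooth_on_add: "smooth_on S f \<Longrightarrow> smooth_on S g \<Longrightarrow> smooth_on S (\<lambda>x. f x + g x)"
  and smooth_on_mult: "smooth_on S f \<Longrightarrow> smooth_on S g \<Longrightarrow> smooth_on S (\<lambda>x. f x * g x)"
  by (simp_all add: smooth_on_iff_times_diff_on[OF S] times_diff_on_add times_diff_on_mult)

lemma smooth_on_diff: "smooth_on S f \<Longrightarrow> smooth_on S g \<Longrightarrow> smooth_on S (\<lambda>x. f x - g x)"
  using smooth_on_add[OF _ smooth_on_mult[OF smooth_on_const[of "-1"]]] by simp

lemma smooth_on_power: "smooth_on S f \<Longrightarrow> smooth_on S (\<lambda>x. f x ^ n)"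
  by (induction n) (simp_all add: smooth_on_const smooth_on_mult)

lemma smooth_on_compose:
  "dense_in_itself T \<Longrightarrow> smooth_on T f \<Longrightarrow> smooth_on S g \<Longrightarrow> g ` S \<subseteq> T \<Longrightarrow> smooth_on S (\<lambda>x. f (g x))"
  by (simp add: smooth_on_iff_times_diff_on S times_diff_on_compose)

text \<open>The bootstrap: if \<open>f\<close> is \<open>n\<close> times differentiable, then so is its derivative \<open>r \<circ> f\<close>.\<close>

lemma smooth_on_autonomous_ode:
  assumes "smooth_on T r" "f ` S \<subseteq> T"
    "\<And>x. x \<in> S \<Longrightarrow> (f has_real_derivative r (f x)) (at x within S)"
  shows "smooth_on S f"
  unfolding smooth_on_iff_times_diff_on[OF S]
proof
  fix n show "times_diff_on S n f"
  proof (induction n)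
    case (Suc n)
    then have "times_diff_on S n (\<lambda>x. r (f x))"
      by (rule times_diff_on_compose[OF assms(2) smooth_on_imp_times_diff_on[OF assms(1)]])
    then show ?case using assms(3) by (auto intro: exI[of _ "\<lambda>x. r (f x)"])
  qed simp
qed

end

text \<open>The induction generalises the exponent, since each derivative is a constant times a
  power with exponent lowered by one.\<close>

lemma smooth_on_powr: "smooth_on {0<..} (\<lambda>x. x powr a)"
proof -
  have "times_diff_on {0<..} n (\<lambda>x. x powr a)" for n
  proof (induction n arbitrary: a)
    case (Suc n)
    have "((\<lambda>x. x powr a) has_real_derivative a * x powr (a - 1)) (at x within {0<..})" if "x > 0" for x
      using has_field_derivative_at_within[OF has_real_derivative_powr[OF that]] by simp
    moreover have "times_diff_on {0<..} n (\<lambda>x. a * x powr (a - 1))"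
      using Suc by (intro times_diff_on_mult) auto
    ultimately show ?case by (auto intro: exI[of _ "\<lambda>x. a * x powr (a - 1)"])
  qed simp
  then show ?thesis
    by (simp add: smooth_on_iff_times_diff_on dense_in_itself_open)
qed

lemma smooth_on_powr_compose:
  assumes S: "dense_in_itself S" and f: "smooth_on S f" and pos: "\<And>x. x \<in> S \<Longrightarrow> f x > 0"
  shows "smooth_on S (\<lambda>x. f x powr a)"
  using smooth_on_compose[OF S _ smooth_on_powr f, of a] pos by (auto simp: dense_in_itself_open)

lemma smooth_on_sqrt:
  assumes "dense_in_itself S" "smooth_on S f" "\<And>x. x \<in> S \<Longrightarrow> f x > 0"
  shows "smooth_on S (\<lambda>x. sqrt (f x))"
  using smooth_on_cong[OF assms(1) _ smooth_on_powr_compose[OF assms, of "1 / 2"]] assms(3)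
  by (simp add: powr_half_sqrt less_imp_le)

lemma smooth_on_inverse:
  assumes "dense_in_itself S" "smooth_on S f" "\<And>x. x \<in> S \<Longrightarrow> f x > 0"
  shows "smooth_on S (\<lambda>x. inverse (f x))"
  using smooth_on_cong[OF assms(1) _ smooth_on_powr_compose[OF assms, of "-1"]] assms(3)
  by (simp add: powr_minus less_imp_le)

section \<open>Hadamard's lemma and Taylor factorisation at a point\<close>

text \<open>Differentiating under the integral sign replaces \<open>f\<close> by its derivative and
  \<open>k\<close> by \<open>Suc k\<close>. The weight \<open>t ^ k\<close> is there to make the
  family closed under this operation, so the induction runs over all \<open>f\<close> and
  \<open>k\<close>.\<close>

lemma smooth_on_integral_dilation:
  fixes c :: real
  assumes S: "dense_in_itself S" "convex S" "c \<in> S" and f: "smooth_on S f"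
  shows "smooth_on S (\<lambda>x. integral {0..1} (\<lambda>t. t ^ k * f (c + t * (x - c))))"
proof -
  have in_S: "c + t * (x - c) \<in> S" if "x \<in> S" "t \<in> {0..1}" for x t
    using convexD_alt[OF S(2,3) that(1), of t] that(2) by (simp add: algebra_simps)
  have cont: "continuous_on (S \<times> {0..1}) (\<lambda>(x, t). t ^ k * f (c + t * (x - c)))"
    if "smooth_on S f" for f k
  proof -
    have "continuous_on (S \<times> {0..1}) (\<lambda>z. f (c + snd z * (fst z - c)))"
      by (rule continuous_on_compose2[OF smooth_on_imp_continuous_on[OF that]])
        (auto intro!: continuous_intros in_S)
    then show ?thesis
      by (auto simp: case_prod_unfold intro!: continuous_intros)
  qed
  have int: "(\<lambda>t. t ^ k * f (c + t * (x - c))) integrable_on cbox 0 1" if "smooth_on S f" "x \<in> S" for f k x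
  proof -
    have "continuous_on {0..1} (\<lambda>t. case (x, t) of (x, t) \<Rightarrow> t ^ k * f (c + t * (x - c)))"
      by (rule continuous_on_compose2[OF cont[OF that(1), of k], where f = "\<lambda>t. (x, t)"])
        (use that(2) in \<open>auto intro!: continuous_intros\<close>)
    then show ?thesis
      by (auto intro!: integrable_continuous_real)
  qed
  have deriv: "((\<lambda>x. integral {0..1} (\<lambda>t. t ^ k * f (c + t * (x - c)))) has_real_derivative
      integral {0..1} (\<lambda>t. t ^ Suc k * deriv_within S f (c + t * (x - c)))) (at x within S)"
    if f: "smooth_on S f" and x: "x \<in> S" for f k x
  proof -
    have "((\<lambda>x. t ^ k * f (c + t * (x - c))) has_real_derivative
        t ^ Suc k * deriv_within S f (c + t * (x - c))) (at x within S)"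
      if "x \<in> S" "t \<in> cbox 0 1" for x t
    proof -
      have "((\<lambda>x. c + t * (x - c)) has_real_derivative t) (at x within S)"
        by (auto intro!: derivative_eq_intros)
      moreover have "(\<lambda>x. c + t * (x - c)) ` S \<subseteq> S"
        using in_S that(2) by auto
      ultimately have "((\<lambda>x. f (c + t * (x - c))) has_real_derivative
          deriv_within S f (c + t * (x - c)) * t) (at x within S)"
        using smooth_on_DERIV[OF f in_S[OF that(1)]] that(2)
        by (intro DERIV_compose_within[where T = S and g = "\<lambda>x. c + t * (x - c)"]) auto
      from DERIV_cmult[OF this, of "t ^ k"] show ?thesis by (simp add: algebra_simps)
    qed
    \<comment> \<open>The Leibniz rule wants the differentiated integrand jointly continuous in
      \<open>x\<close> and \<open>t\<close>; this is \<open>cont\<close> for the derivative of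
      \<open>f\<close> with weight \<open>Suc k\<close>.\<close>
    from leibniz_rule_field_derivative[OF this int[OF f] _ x S(2)] show ?thesis
      using cont[OF smooth_on_deriv_within[OF f], of "Suc k"] by simp
  qed
  have "times_diff_on S n (\<lambda>x. integral {0..1} (\<lambda>t. t ^ k * f (c + t * (x - c))))" for n
    using f
  proof (induction n arbitrary: f k)
    case (Suc n)
    show ?case
      unfolding times_diff_on.simps
      by (rule exI, rule conjI, rule ballI, erule deriv[OF Suc.prems],
          rule Suc.IH[OF smooth_on_deriv_within[OF Suc.prems]])
  qed simp
  then show ?thesis
    by (simp add: smooth_on_iff_times_diff_on[OF S(1)])
qed

text \<open>The fundamental theorem along the segment from \<open>c\<close> to \<open>x\<close>
  gives the quotient as the mean of the derivative over that segment. No division by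
  \<open>x - c\<close> occurs, hence smoothness at \<open>c\<close> itself.\<close>

lemma Hadamard:
  fixes c :: real
  assumes S: "dense_in_itself S" "convex S" "c \<in> S" and f: "smooth_on S f"
  obtains q where "smooth_on S q" "\<And>x. x \<in> S \<Longrightarrow> f x = f c + (x - c) * q x"
proof
  define q where "q x = integral {0..1} (\<lambda>t. deriv_within S f (c + t * (x - c)))" for x
  show "smooth_on S q"
    using smooth_on_integral_dilation[OF S smooth_on_deriv_within[OF f], of 0] by (simp add: q_def[abs_def])
  fix x assume x: "x \<in> S"
  have in_S: "c + t * (x - c) \<in> S" if "t \<in> {0..1}" for t
    using convexD_alt[OF S(2,3) x, of t] that by (simp add: algebra_simps)
  have "((\<lambda>t. f (c + t * (x - c))) has_real_derivative
      deriv_within S f (c + t * (x - c)) * (x - c)) (at t within {0..1})" if "t \<in> {0..1}" for t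
  proof -
    have "((\<lambda>t. c + t * (x - c)) has_real_derivative x - c) (at t within {0..1})"
      by (auto intro!: derivative_eq_intros)
    moreover have "(\<lambda>t. c + t * (x - c)) ` {0..1} \<subseteq> S"
      using in_S by auto
    ultimately show ?thesis
      using smooth_on_DERIV[OF f in_S[OF that]] by (intro DERIV_compose_within[where T = S and g = "\<lambda>t. c + t * (x - c)"])
  qed
  then have "((\<lambda>t. deriv_within S f (c + t * (x - c)) * (x - c)) has_integral
      f (c + 1 * (x - c)) - f (c + 0 * (x - c))) {0..1}"
    by (intro fundamental_theorem_of_calculus)
      (auto simp: has_real_derivative_iff_has_vector_derivative)
  then have "integral {0..1} (\<lambda>t. deriv_within S f (c + t * (x - c)) * (x - c)) = f x - f c"
    by (simp only: integral_unique) simp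
  then show "f x = f c + (x - c) * q x"
    by (simp add: q_def mult.commute)
qed

text \<open>One differentiation turns \<open>(x - c) ^ n * q x\<close> into a product of the same
  kind, with exponent \<open>n - 1\<close> and cofactor \<open>r\<close> satisfying
  \<open>r c = n * q c\<close>; these factors accumulate to the factorial.\<close>

lemma nth_deriv_within_power_mult:
  assumes S: "dense_in_itself S" "c \<in> S"
  shows "smooth_on S q \<Longrightarrow> k \<le> n \<Longrightarrow>
    nth_deriv_within S k (\<lambda>x. (x - c) ^ n * q x) c = (if k = n then fact n * q c else 0)"
proof (induction k arbitrary: n q)
  case (Suc k)
  then obtain n' where n: "n = Suc n'" by (cases n) auto
  define r where "r x = real n * q x + (x - c) * deriv_within S q x" for x
  have r: "smooth_on S r"
    unfolding r_def using S Suc.prems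
    by (intro smooth_on_add smooth_on_mult smooth_on_const smooth_on_diff smooth_on_ident smooth_on_deriv_within)
  have sm: "smooth_on S (\<lambda>x. (x - c) ^ n * q x)"
    using S Suc.prems by (intro smooth_on_mult smooth_on_power smooth_on_const smooth_on_diff smooth_on_ident)
  have "deriv_within S (\<lambda>x. (x - c) ^ n * q x) x = (x - c) ^ n' * r x" if x: "x \<in> S" for x
  proof (rule deriv_within_eq[OF S(1) x])
    have "((\<lambda>x. (x - c) ^ n) has_real_derivative real n * (x - c) ^ n') (at x within S)"
      using DERIV_power[OF DERIV_diff[OF DERIV_ident DERIV_const[of c]], where n = n] by (simp add: n)
    from DERIV_mult[OF this smooth_on_DERIV[OF Suc.prems(1) x]]
    show "((\<lambda>x. (x - c) ^ n * q x) has_real_derivative (x - c) ^ n' * r x) (at x within S)"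
      by (simp add: n r_def algebra_simps)
  qed
  from nth_deriv_within_cong[OF S(1) this smooth_on_deriv_within[OF sm] S(2)]
  have "nth_deriv_within S (Suc k) (\<lambda>x. (x - c) ^ n * q x) c = nth_deriv_within S k (\<lambda>x. (x - c) ^ n' * r x) c"
    by (simp add: nth_deriv_within_Suc)
  also have "\<dots> = (if Suc k = n then fact n * q c else 0)"
    using Suc.IH[OF r] Suc.prems(2) by (simp add: n r_def algebra_simps)
  finally show ?case .
qed simp

text \<open>Iterated Hadamard: as long as the next derivative at \<open>c\<close> vanishes, so does
  the current cofactor at \<open>c\<close>, and another factor \<open>x - c\<close> can be split
  off.\<close>

lemma smooth_on_factor_power:
  assumes S: "dense_in_itself S" "convex S" "c \<in> S" and f: "smooth_on S f"
    and zero: "\<And>k. k < n \<Longrightarrow> nth_deriv_within S k f c = 0"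
  obtains q where "smooth_on S q" "\<And>x. x \<in> S \<Longrightarrow> f x = (x - c) ^ n * q x"
    "q c = nth_deriv_within S n f c / fact n"
proof -
  have "\<exists>q. smooth_on S q \<and> (\<forall>x\<in>S. f x = (x - c) ^ n * q x)"
    using zero
  proof (induction n)
    case 0
    then show ?case using f by auto
  next
    case (Suc n)
    then obtain q where q: "smooth_on S q" "\<And>x. x \<in> S \<Longrightarrow> f x = (x - c) ^ n * q x"
      by auto
    have "fact n * q c = 0"
      using nth_deriv_within_cong[OF S(1) q(2) f S(3), of n] Suc.prems[of n]
        nth_deriv_within_power_mult[OF S(1,3) q(1), of n n] by simp
    moreover obtain r where "smooth_on S r" "\<And>x. x \<in> S \<Longrightarrow> q x = q c + (x - c) * r x"
      using Hadamard[OF S q(1)] by blast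
    ultimately show ?case
      using q by (intro exI[of _ r]) auto
  qed
  then obtain q where q: "smooth_on S q" "\<And>x. x \<in> S \<Longrightarrow> f x = (x - c) ^ n * q x"
    by auto
  moreover have "q c = nth_deriv_within S n f c / fact n"
    using nth_deriv_within_cong[OF S(1) q(2) f S(3), of n]
      nth_deriv_within_power_mult[OF S(1,3) q(1), of n n] by simp
  ultimately show thesis using that by blast
qed

section \<open>Signed square roots\<close>

text \<open>\<open>\<Psi>\<close> is the inverse of the signed square root \<open>\<Phi>\<close> of \<open>H - H c\<close>.\<close>

lemma signed_root_chart:
  fixes H H' :: "real \<Rightarrow> real"
  assumes smooth: "smooth_on {0<..} H" and c: "c > 0"
    and H': "\<And>u. u > 0 \<Longrightarrow> (H has_real_derivative H' u) (at u)"
    and neg: "\<And>u. 0 < u \<Longrightarrow> u < c \<Longrightarrow> H' u < 0" and crit: "H' c = 0"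
    and pos: "\<And>u. c < u \<Longrightarrow> H' u > 0"
    and H'': "(H' has_real_derivative k) (at c)" "k > 0"
    and left: "\<And>M. \<exists>u. 0 < u \<and> u < c \<and> H u \<ge> M" and right: "\<And>M. \<exists>u>c. H u \<ge> M"
  obtains \<Psi> \<psi> where "smooth_on UNIV \<Psi>" "smooth_on UNIV \<psi>" "\<And>s. \<Psi> s > 0" "\<And>s. \<psi> s > 0"
    "\<And>s. H (\<Psi> s) = H c + s\<^sup>2" "\<And>s. \<Psi> s = c + s * \<psi> s" "\<psi> 0 = sqrt (2 / k)"
    "strict_mono \<Psi>" "\<And>u. u > 0 \<Longrightarrow> \<exists>s. \<Psi> s = u"
proof -
  define S where "S = {0::real<..}"
  have S: "dense_in_itself S" "convex S" "c \<in> S" "open S"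
    using c by (auto simp: S_def dense_in_itself_open)
  have at_S: "at u within S = at u" if "u > 0" for u
    using at_within_open[of u S] that S(4) by (auto simp: S_def)
  define h where "h u = H u - H c" for u
  have h: "smooth_on S h"
    unfolding h_def S_def
    using smooth S(1) by (intro smooth_on_diff smooth_on_const) (auto simp: S_def)
  have h': "(h has_real_derivative H' u) (at u)" if "u > 0" for u
    unfolding h_def using H'[OF that] by (auto intro!: derivative_eq_intros)
  have dh: "deriv_within S h u = H' u" if "u \<in> S" for u
    using that h' at_S by (intro deriv_within_eq[OF S(1)]) (auto simp: S_def)
  have "deriv_within S (deriv_within S h) c = k"
  proof (rule deriv_within_eq[OF S(1,3)])
    show "(deriv_within S h has_real_derivative k) (at c within S)"
      by (rule has_real_derivative_cong_on[of S H']) (use dh H''(1) at_S c S(3) in auto)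
  qed
  then have h2: "nth_deriv_within S 2 h c = k"
    by (simp add: nth_deriv_within_Suc numeral_2_eq_2)
  have "nth_deriv_within S j h c = 0" if "j < 2" for j
    using that dh[OF S(3)] crit by (cases j) (auto simp: h_def nth_deriv_within_Suc)
  \<comment> \<open>At the nondegenerate critical point both \<open>h\<close> and its derivative
    vanish, so a square splits off, and the cofactor at \<open>c\<close> is half the second
    derivative.\<close>
  then obtain K where K: "smooth_on S K" "\<And>u. u \<in> S \<Longrightarrow> h u = (u - c)\<^sup>2 * K u"
    "K c = nth_deriv_within S 2 h c / fact 2"
    using smooth_on_factor_power[OF S(1-3) h, of 2] by blast
  have Kc: "K c = k / 2" using K(3) h2 by simp
  have h_cont: "continuous_on {a..b} h" if "a > 0" for a b
    using smooth_on_imp_continuous_on[OF h] by (rule continuous_on_subset) (use that in \<open>auto simp: S_def\<close>)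
  have h_pos: "h u > 0" if u: "u > 0" "u \<noteq> c" for u
  proof (cases "u < c")
    case True
    have "h u > h c"
    proof (rule DERIV_neg_imp_decreasing_open[OF True])
      fix x assume "u < x" "x < c"
      then show "\<exists>y. (h has_real_derivative y) (at x) \<and> y < 0"
        using h'[of x] neg[of x] u by (intro exI[of _ "H' x"]) auto
    qed (use h_cont u in simp)
    then show ?thesis by (simp add: h_def)
  next
    case False
    then have "c < u" using u by simp
    then have "h c < h u"
    proof (rule DERIV_pos_imp_increasing_open)
      fix x assume "c < x" "x < u"
      then show "\<exists>y. (h has_real_derivative y) (at x) \<and> y > 0"
        using h'[of x] pos[of x] c by (intro exI[of _ "H' x"]) auto
    qed (use h_cont c in simp)
    then show ?thesis by (simp add: h_def)
  qed
  have K_pos: "K u > 0" if "u \<in> S" for u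
  proof (cases "u = c")
    case False
    then show ?thesis
      using h_pos[of u] K(2)[OF that] that by (auto simp: S_def zero_less_mult_iff)
  qed (simp add: Kc H''(2))
  \<comment> \<open>Taking the root of \<open>K\<close> only, and keeping the sign of
    \<open>u - c\<close>, avoids the corner that \<open>sqrt (h u)\<close> would have at
    \<open>c\<close>.\<close>
  define \<Phi> where "\<Phi> u = (u - c) * sqrt (K u)" for u
  have sqrtK: "smooth_on S (\<lambda>u. sqrt (K u))"
    using S(1) K(1) K_pos by (rule smooth_on_sqrt)
  have \<Phi>: "smooth_on S \<Phi>"
    unfolding \<Phi>_def[abs_def]
    using S(1) sqrtK by (intro smooth_on_mult smooth_on_diff smooth_on_ident smooth_on_const)
  have \<Phi>_sq: "(\<Phi> u)\<^sup>2 = h u" if "u > 0" for u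
    using K(2) K_pos that by (simp add: \<Phi>_def power_mult_distrib S_def less_imp_le)
  define \<Phi>' where "\<Phi>' = deriv_within S \<Phi>"
  have D\<Phi>: "(\<Phi> has_real_derivative \<Phi>' u) (at u)" if "u > 0" for u
    using smooth_on_DERIV[OF \<Phi>, of u] that at_S by (simp add: \<Phi>'_def S_def)
  have \<Phi>'c: "\<Phi>' c = sqrt (k / 2)"
  proof -
    have "((\<lambda>u. sqrt (K u)) has_real_derivative deriv_within S (\<lambda>u. sqrt (K u)) c) (at c)"
      using smooth_on_DERIV[OF sqrtK S(3)] at_S[OF c] by simp
    from DERIV_mult[OF DERIV_diff[OF DERIV_ident DERIV_const[of c]] this]
    have "(\<Phi> has_real_derivative sqrt (K c)) (at c)"
      by (simp add: \<Phi>_def[abs_def])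
    then show ?thesis using DERIV_unique D\<Phi>[OF c] Kc by auto
  qed
  \<comment> \<open>Away from \<open>c\<close>, differentiating \<open>\<Phi>^2 = h\<close> gives
    \<open>H' = 2 * \<Phi> * \<Phi>'\<close>, where \<open>H'\<close> and \<open>\<Phi>\<close> have
    the same sign. At \<open>c\<close> this reads \<open>0 = 0\<close>, and the value
    \<open>sqrt (k / 2)\<close> is used instead.\<close>
  have \<Phi>'_pos: "\<Phi>' u > 0" if u: "u > 0" for u
  proof (cases "u = c")
    case False
    have "((\<lambda>u. (\<Phi> u)\<^sup>2) has_real_derivative 2 * \<Phi> u * \<Phi>' u) (at u)"
      using D\<Phi>[OF u] by (auto intro!: derivative_eq_intros)
    then have "((\<lambda>u. (\<Phi> u)\<^sup>2) has_real_derivative 2 * \<Phi> u * \<Phi>' u) (at u within S)"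
      by (rule has_field_derivative_at_within)
    then have "(h has_real_derivative 2 * \<Phi> u * \<Phi>' u) (at u within S)"
      by (rule has_real_derivative_cong_on[rotated 2]) (use \<Phi>_sq u in \<open>auto simp: S_def\<close>)
    then have eq: "H' u = 2 * \<Phi> u * \<Phi>' u"
      using h'[OF u] DERIV_unique at_S[OF u] by auto
    have sK: "sqrt (K u) > 0" using K_pos u by (simp add: S_def)
    show ?thesis
    proof (cases "u < c")
      case True
      then have "\<Phi> u < 0" using sK by (simp add: \<Phi>_def mult_less_0_iff)
      then show ?thesis using neg[OF u True] eq by (simp add: mult_less_0_iff)
    next
      case False
      then have "c < u" using \<open>u \<noteq> c\<close> by simp
      then have "\<Phi> u > 0" using sK by (simp add: \<Phi>_def)
      then show ?thesis using pos[OF \<open>c < u\<close>] eq by (simp add: zero_less_mult_iff)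
    qed
  qed (simp add: \<Phi>'c H''(2))
  have mono: "\<Phi> u < \<Phi> v" if "0 < u" "u < v" for u v
  proof (rule DERIV_pos_imp_increasing[OF that(2)])
    fix x assume "u \<le> x" "x \<le> v"
    then show "\<exists>y. (\<Phi> has_real_derivative y) (at x) \<and> y > 0"
      using D\<Phi>[of x] \<Phi>'_pos[of x] that(1) by (intro exI[of _ "\<Phi>' x"]) auto
  qed
  have inj: "u = v" if "\<Phi> u = \<Phi> v" "0 < u" "0 < v" for u v
    using that mono[of u v] mono[of v u] by (cases u v rule: linorder_cases) auto
  \<comment> \<open>Both ends are chosen with \<open>H - H c\<close> at least \<open>s^2\<close>, so
    \<open>\<Phi>\<close> lies below \<open>- \<bar>s\<bar>\<close> at \<open>a\<close> and above
    \<open>\<bar>s\<bar>\<close> at \<open>b\<close>; the intermediate value theorem does the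
    rest.\<close>
  have surj: "\<exists>u>0. \<Phi> u = s" for s
  proof -
    obtain a where a: "0 < a" "a < c" "H a \<ge> H c + s\<^sup>2" using left by blast
    obtain b where b: "b > c" "H b \<ge> H c + s\<^sup>2" using right by blast
    have "\<Phi> a < 0" using a K_pos[of a] by (simp add: \<Phi>_def S_def mult_less_0_iff)
    moreover have "s\<^sup>2 \<le> (\<Phi> a)\<^sup>2" using a \<Phi>_sq by (simp add: h_def)
    ultimately have 1: "\<Phi> a \<le> s" using abs_le_square_iff[of s "\<Phi> a"] by simp
    have "\<Phi> b > 0" using b c K_pos[of b] by (simp add: \<Phi>_def S_def)
    moreover have "s\<^sup>2 \<le> (\<Phi> b)\<^sup>2" using b c \<Phi>_sq by (simp add: h_def)
    ultimately have 2: "s \<le> \<Phi> b" using abs_le_square_iff[of s "\<Phi> b"] by simp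
    have "continuous_on {a..b} \<Phi>"
      using smooth_on_imp_continuous_on[OF \<Phi>] by (rule continuous_on_subset) (use a in \<open>auto simp: S_def\<close>)
    from IVT'[OF 1 2 _ this] a b obtain x where "x \<ge> a" "\<Phi> x = s" by auto
    then show ?thesis using a(1) by (intro exI[of _ x]) simp
  qed
  then obtain \<Psi> where \<Psi>: "\<And>s. \<Psi> s > 0" "\<And>s. \<Phi> (\<Psi> s) = s" by metis
  have \<Psi>\<Phi>: "\<Psi> (\<Phi> u) = u" if "u > 0" for u
    using inj \<Psi> that by simp
  have contPsi: "isCont \<Psi> s" for s
  proof -
    \<comment> \<open>The radius \<open>\<Psi> s / 2\<close> keeps the interval around
      \<open>\<Psi> s\<close> inside the positive half-line, where \<open>\<Psi>\<close> is known to
      invert \<open>\<Phi>\<close>.\<close>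
    have half: "z > 0" if "\<bar>z - \<Psi> s\<bar> \<le> \<Psi> s / 2" for z
      using that \<Psi>(1)[of s] by linarith
    have "isCont \<Psi> (\<Phi> (\<Psi> s))"
      by (rule isCont_inverse_function[where d = "\<Psi> s / 2" and x = "\<Psi> s" and f = \<Phi>]) (use \<Psi>(1) \<Psi>\<Phi> half DERIV_isCont[OF D\<Phi>] in auto)
    then show ?thesis by (simp add: \<Psi>(2))
  qed
  \<comment> \<open>The bounds \<open>s - 1\<close> and \<open>s + 1\<close> are an arbitrary
    neighbourhood, as \<open>\<Phi> (\<Psi> s) = s\<close> holds on the whole line.\<close>
  have D\<Psi>: "(\<Psi> has_real_derivative inverse (\<Phi>' (\<Psi> s))) (at s)" for s
    by (rule DERIV_inverse_function[of \<Phi> _ _ _ "s - 1" "s + 1"])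
      (use D\<Phi> \<Psi> \<Phi>'_pos[of "\<Psi> s"] contPsi in auto)
  \<comment> \<open>The inverse solves the autonomous equation
    \<open>\<Psi>' = 1 / \<Phi>' (\<Psi>)\<close> with smooth right-hand side, so the bootstrap
    applies.\<close>
  have sm\<Psi>: "smooth_on UNIV \<Psi>"
  proof (rule smooth_on_autonomous_ode)
    show "smooth_on S (\<lambda>u. inverse (\<Phi>' u))"
      using S(1) smooth_on_deriv_within[OF \<Phi>] \<Phi>'_pos unfolding \<Phi>'_def
      by (intro smooth_on_inverse) (auto simp: S_def)
  qed (use \<Psi> D\<Psi> in \<open>auto simp: S_def dense_in_itself_open\<close>)
  have \<Psi>0: "\<Psi> 0 = c" using \<Psi>\<Phi>[OF c] by (simp add: \<Phi>_def)
  obtain \<psi> where \<psi>: "smooth_on UNIV \<psi>" "\<And>s. \<Psi> s = c + s * \<psi> s"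
    using Hadamard[OF _ _ _ sm\<Psi>, of 0] \<Psi>0 by (auto simp: dense_in_itself_open)
  have "strict_mono \<Psi>"
  proof (rule strict_monoI)
    fix s t :: real assume "s < t"
    then show "\<Psi> s < \<Psi> t"
      using mono[of "\<Psi> t" "\<Psi> s"] \<Psi> by (cases "\<Psi> s" "\<Psi> t" rule: linorder_cases) (auto, metis less_irrefl)
  qed
  have "(\<psi> has_real_derivative deriv_within UNIV \<psi> 0) (at 0)"
    using smooth_on_DERIV[OF \<psi>(1), of 0] by simp
  then have "((\<lambda>s. c + s * \<psi> s) has_real_derivative \<psi> 0) (at 0)"
    by (auto intro!: derivative_eq_intros)
  moreover have "(\<lambda>s. c + s * \<psi> s) = \<Psi>"
    by (rule ext) (rule \<psi>(2)[symmetric])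
  ultimately have "(\<Psi> has_real_derivative \<psi> 0) (at 0)"
    by simp
  then have \<psi>0: "\<psi> 0 = sqrt (2 / k)"
    using DERIV_unique[OF D\<Psi>[of 0]] \<Phi>'c by (simp add: \<Psi>0 real_sqrt_divide)
  \<comment> \<open>Off \<open>0\<close> this is the secant slope of the increasing
    \<open>\<Psi>\<close>; at \<open>0\<close> it is the derivative computed above.\<close>
  have "\<psi> s > 0" for s
  proof (cases s "0::real" rule: linorder_cases)
    case less
    then show ?thesis
      using strict_monoD[OF \<open>strict_mono \<Psi>\<close> less] \<psi>(2)[of s] \<Psi>0 by (simp add: mult_less_0_iff)
  next
    case equal
    then show ?thesis using \<psi>0 H''(2) by simp
  next
    case greater
    then show ?thesis
      using strict_monoD[OF \<open>strict_mono \<Psi>\<close> greater] \<psi>(2)[of s] \<Psi>0 by (simp add: zero_less_mult_iff)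
  qed
  moreover have "H (\<Psi> s) = H c + s\<^sup>2" for s
    using \<Phi>_sq[OF \<Psi>(1), of s] \<Psi>(2)[of s] by (simp add: h_def)
  ultimately show thesis
    using that[of \<Psi> \<psi>] sm\<Psi> \<psi> \<Psi>(1) \<psi>0 \<open>strict_mono \<Psi>\<close> \<Psi>\<Phi> by blast
qed

text \<open>The primitive vanishes to the even order \<open>4 * m + 2\<close> at \<open>0\<close>
  and is positive elsewhere, so it is \<open>x ^ (4 * m + 2)\<close> times a positive smooth
  \<open>G\<close>. The signed root is then \<open>x ^ (2 * m + 1) * sqrt (G x)\<close>, whose odd
  power carries the sign.\<close>

lemma signed_root_of_primitive:
  fixes L0 L1 :: real
  defines "S \<equiv> {L0..L1}"
  assumes L: "L0 < 0" "0 < L1" and f: "smooth_on S f"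
    and neg: "\<And>x. L0 \<le> x \<Longrightarrow> x < 0 \<Longrightarrow> f x < 0" and zero: "f 0 = 0"
    and pos: "\<And>x. 0 < x \<Longrightarrow> x \<le> L1 \<Longrightarrow> f x > 0"
    and flat: "\<And>k. k \<in> {1..4 * m} \<Longrightarrow> nth_deriv_within S k f 0 = 0"
    and top: "nth_deriv_within S (4 * m + 1) f 0 > 0"
  obtains w where "smooth_on S w" "\<And>x. x \<in> S \<Longrightarrow> w x > 0"
    "\<And>x. x \<in> S \<Longrightarrow> (x ^ (2 * m + 1) * w x)\<^sup>2 = integral {L0..x} f - integral {L0..0} f"
    "w 0 = sqrt (nth_deriv_within S (4 * m + 1) f 0 / fact (4 * m + 2))"
    "strict_mono_on S (\<lambda>x. x ^ (2 * m + 1) * w x)"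
proof -
  have S: "dense_in_itself S" "convex S" "0 \<in> S"
    using L by (auto simp: S_def dense_in_itself_Icc)
  \<comment> \<open>A difference of two integrals expresses the oriented integral from
    \<open>0\<close> to \<open>x\<close>; \<open>integral {0..x} f\<close> would be \<open>0\<close>
    for negative \<open>x\<close>, its range being empty.\<close>
  define F where "F x = integral {L0..x} f - integral {L0..0} f" for x
  have F': "(F has_real_derivative f x) (at x within S)" if "x \<in> S" for x
    unfolding F_def S_def
    using integral_has_real_derivative[OF smooth_on_imp_continuous_on[OF f[unfolded S_def]]] that
    by (auto intro!: derivative_eq_intros simp: S_def)
  have F: "smooth_on S F"
    using S(1) F' f by (rule smooth_on_of_DERIV)
  have "nth_deriv_within S (Suc k) F 0 = nth_deriv_within S k f 0" for k
    unfolding nth_deriv_within_Suc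
    by (rule nth_deriv_within_cong[OF S(1) deriv_within_eq[OF S(1) _ F']])
      (use S(3) smooth_on_deriv_within[OF F] in auto)
  moreover have "nth_deriv_within S k f 0 = 0" if "k < 4 * m + 1" for k
    using that zero flat by (cases k) auto
  ultimately have "nth_deriv_within S k F 0 = 0" if "k < 4 * m + 2" for k
    using that by (cases k) (auto simp: F_def)
  then obtain G where "smooth_on S G" "\<And>x. x \<in> S \<Longrightarrow> F x = (x - 0) ^ (4 * m + 2) * G x"
    "G 0 = nth_deriv_within S (4 * m + 2) F 0 / fact (4 * m + 2)"
    using smooth_on_factor_power[OF S F, of "4 * m + 2"] by blast
  then have G: "smooth_on S G" "\<And>x. x \<in> S \<Longrightarrow> F x = x ^ (4 * m + 2) * G x"
    "G 0 = nth_deriv_within S (4 * m + 2) F 0 / fact (4 * m + 2)"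
    by simp_all
  have G0: "G 0 = nth_deriv_within S (4 * m + 1) f 0 / fact (4 * m + 2)"
    using G(3) \<open>\<And>k. nth_deriv_within S (Suc k) F 0 = nth_deriv_within S k f 0\<close>[of "4 * m + 1"] by simp
  have F'_at: "(F has_real_derivative f x) (at x)" if "L0 < x" "x < L1" for x
    using F'[of x] that at_within_Icc_at[of L0 x L1] by (simp add: S_def)
  have F_cont: "continuous_on {a..b} F" if "L0 \<le> a" "b \<le> L1" for a b
    using smooth_on_imp_continuous_on[OF F] by (rule continuous_on_subset) (use that in \<open>auto simp: S_def\<close>)
  have inc: "F a < F b" if "0 \<le> a" "a < b" "b \<le> L1" for a b
  proof (rule DERIV_pos_imp_increasing_open[OF that(2)])
    fix x assume "a < x" "x < b"
    then show "\<exists>y. (F has_real_derivative y) (at x) \<and> y > 0"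
      using F'_at[of x] pos[of x] that L by (intro exI[of _ "f x"]) auto
  qed (use that L F_cont in simp)
  have dec: "F b < F a" if "L0 \<le> a" "a < b" "b \<le> 0" for a b
  proof (rule DERIV_neg_imp_decreasing_open[OF that(2)])
    fix x assume "a < x" "x < b"
    then show "\<exists>y. (F has_real_derivative y) (at x) \<and> y < 0"
      using F'_at[of x] neg[of x] that L by (intro exI[of _ "f x"]) auto
  qed (use that L F_cont in simp)
  have F0: "F 0 = 0" by (simp add: F_def)
  have G_pos: "G x > 0" if x: "x \<in> S" for x
  proof (cases "x = 0")
    case False
    then have "F x > 0"
      using inc[of 0 x] dec[of x 0] x F0 by (cases "x < 0") (auto simp: S_def)
    moreover have "x ^ (4 * m + 2) > 0"
      using False by (subst zero_less_power_eq) simp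
    ultimately show ?thesis
      unfolding G(2)[OF x] by (rule zero_less_mult_pos)
  qed (use divide_pos_pos[OF top fact_gt_zero, of "4 * m + 2"] G0 in metis)
  define w where "w x = sqrt (G x)" for x
  define g where "g x = x ^ (2 * m + 1) * w x" for x
  have w_pos: "w x > 0" if "x \<in> S" for x
    using G_pos[OF that] by (simp add: w_def)
  have g_sq: "(g x)\<^sup>2 = F x" if "x \<in> S" for x
    using G(2)[OF that] G_pos[OF that]
    by (simp add: g_def w_def power_mult_distrib less_imp_le flip: power_mult) (simp add: algebra_simps power2_eq_square)
  have g_neg: "g x < 0" if "x \<in> S" "x < 0" for x
  proof -
    have "x ^ (2 * m + 1) < 0"
      using that(2) by (subst power_less_zero_eq) simp
    then show ?thesis
      unfolding g_def using w_pos[OF that(1)] by (rule mult_neg_pos)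
  qed
  have g_pos: "g x > 0" if "x \<in> S" "x > 0" for x
    using w_pos[OF that(1)] that(2) by (simp add: g_def)
  have g0: "g 0 = 0" by (simp add: g_def)
  have "strict_mono_on S g"
  proof (rule strict_mono_onI)
    fix a b assume ab: "a \<in> S" "b \<in> S" "a < b"
    \<comment> \<open>On each side of \<open>0\<close> monotonicity of \<open>F\<close> is
      monotonicity of the square of \<open>g\<close>; on the left \<open>F\<close> decreases and the
      squares are compared through \<open>- g\<close>. Across \<open>0\<close> the signs
      decide.\<close>
    consider "0 \<le> a" | "a < 0" "0 < b" | "b \<le> 0" by linarith
    then show "g a < g b"
    proof cases
      case 1
      then have "(g a)\<^sup>2 < (g b)\<^sup>2" using inc ab g_sq by (simp add: S_def)
      then show ?thesis using g_pos[OF ab(2)] 1 ab(3) by (simp add: power2_less_imp_less)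
    next
      case 2
      then show ?thesis using g_neg g_pos ab by (meson order_less_trans)
    next
      case 3
      then have "(- g b)\<^sup>2 < (- g a)\<^sup>2" using dec ab g_sq by (simp add: S_def)
      then show ?thesis using power2_less_imp_less[of "- g b" "- g a"] g_neg[OF ab(1)] 3 ab(3) by simp
    qed
  qed
  moreover have "smooth_on S w"
    unfolding w_def[abs_def] using S(1) G(1) G_pos by (rule smooth_on_sqrt)
  ultimately show thesis
    using that[of w] w_pos g_sq G0 by (auto simp: g_def[abs_def] F_def w_def)
qed

section \<open>Bernoulli function and sonic speed\<close>

text \<open>Kinetic energy plus enthalpy, with the density eliminated by
  \<open>\<rho> = J / u\<close>.\<close>

definition bernoulli :: "real \<Rightarrow> real \<Rightarrow> real \<Rightarrow> real" where
  "bernoulli \<gamma> J u = u\<^sup>2 / 2 + \<gamma> / (\<gamma> - 1) * J powr (\<gamma> - 1) * u powr (1 - \<gamma>)"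

definition bernoulli_deriv :: "real \<Rightarrow> real \<Rightarrow> real \<Rightarrow> real" where
  "bernoulli_deriv \<gamma> J u = u - \<gamma> * J powr (\<gamma> - 1) * u powr (- \<gamma>)"

context
  fixes \<gamma> J :: real
  assumes \<gamma>: "\<gamma> > 1" and J: "J > 0"
begin

lemma sonic_speed_pos: "sonic_speed \<gamma> J > 0"
  using \<gamma> J by (simp add: sonic_speed_def)

text \<open>The equation that characterises the critical point:
  \<open>u = \<gamma> * J powr (\<gamma> - 1) * u powr (- \<gamma>)\<close> multiplied by
  \<open>u powr \<gamma>\<close>.\<close>

lemma sonic_speed_powr: "sonic_speed \<gamma> J powr (\<gamma> + 1) = \<gamma> * J powr (\<gamma> - 1)"
  using \<gamma> J by (simp add: sonic_speed_def powr_mult powr_powr)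

lemma sonic_speed_square:
  "(sonic_speed \<gamma> J)\<^sup>2 = \<gamma> powr (2 / (\<gamma> + 1)) * J powr (2 * (\<gamma> - 1) / (\<gamma> + 1))"
proof -
  have "(sonic_speed \<gamma> J)\<^sup>2 = sonic_speed \<gamma> J powr 2"
    using sonic_speed_pos by simp
  then show ?thesis
    using \<gamma> J by (simp add: sonic_speed_def powr_mult powr_powr del: powr_numeral) (simp add: mult.commute)
qed

text \<open>The right-hand side is the constant in the integral condition on the force, which
  thereby places the sonic level of Bernoulli's law at \<open>0\<close>.\<close>

lemma bernoulli_sonic:
  "bernoulli \<gamma> J (sonic_speed \<gamma> J) =
    (\<gamma> + 1) / (2 * (\<gamma> - 1)) * \<gamma> powr (2 / (\<gamma> + 1)) * J powr (2 * (\<gamma> - 1) / (\<gamma> + 1))"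
proof -
  define c where "c = sonic_speed \<gamma> J"
  have "c powr (\<gamma> + 1) * c powr (1 - \<gamma>) = c\<^sup>2"
    using sonic_speed_pos by (simp add: c_def flip: powr_add)
  then have "\<gamma> * J powr (\<gamma> - 1) * c powr (1 - \<gamma>) = c\<^sup>2"
    using sonic_speed_powr by (simp add: c_def)
  then have "bernoulli \<gamma> J c = c\<^sup>2 / 2 + c\<^sup>2 / (\<gamma> - 1)"
    by (simp add: bernoulli_def)
  also have "\<dots> = (\<gamma> + 1) / (2 * (\<gamma> - 1)) * c\<^sup>2"
    using \<gamma> by (simp add: field_simps)
  finally show ?thesis
    using sonic_speed_square by (simp add: c_def)
qed

lemma bernoulli_DERIV:
  "u > 0 \<Longrightarrow> (bernoulli \<gamma> J has_real_derivative bernoulli_deriv \<gamma> J u) (at u)"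
proof -
  assume u: "u > 0"
  define A where "A = \<gamma> / (\<gamma> - 1) * J powr (\<gamma> - 1)"
  have "((\<lambda>u. u\<^sup>2 / 2 + A * u powr (1 - \<gamma>)) has_real_derivative
      u + A * ((1 - \<gamma>) * u powr (1 - \<gamma> - 1))) (at u)"
    by (intro DERIV_add DERIV_cmult has_real_derivative_powr[OF u]) (auto intro!: derivative_eq_intros)
  moreover have "A * ((1 - \<gamma>) * u powr (1 - \<gamma> - 1)) = - \<gamma> * J powr (\<gamma> - 1) * u powr (- \<gamma>)"
    using \<gamma> by (simp add: A_def field_simps)
  ultimately show ?thesis
    by (simp add: bernoulli_def[abs_def] bernoulli_deriv_def A_def)
qed

text \<open>Factored so that the sign is read off from comparing \<open>u\<close> with the sonic
  speed.\<close>

lemma bernoulli_deriv_eq: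
  assumes "u > 0"
  shows "bernoulli_deriv \<gamma> J u = u powr (- \<gamma>) * (u powr (\<gamma> + 1) - sonic_speed \<gamma> J powr (\<gamma> + 1))"
proof -
  have "u powr (- \<gamma>) * u powr (\<gamma> + 1) = u"
    using assms by (simp flip: powr_add)
  then show ?thesis
    unfolding sonic_speed_powr by (simp add: bernoulli_deriv_def algebra_simps)
qed

text \<open>By \<open>sonic_speed_powr\<close> the powers cancel in the second derivative. Its value
  \<open>\<gamma> + 1\<close> is the source of that factor in the slope at the sonic point.\<close>

lemma bernoulli_deriv_DERIV_sonic:
  "(bernoulli_deriv \<gamma> J has_real_derivative \<gamma> + 1) (at (sonic_speed \<gamma> J))"
proof -
  define c where "c = sonic_speed \<gamma> J"
  have c: "c > 0" using sonic_speed_pos by (simp add: c_def)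
  have "(bernoulli_deriv \<gamma> J has_real_derivative 1 + \<gamma> * (\<gamma> * J powr (\<gamma> - 1)) * c powr (- \<gamma> - 1)) (at c)"
    unfolding bernoulli_deriv_def[abs_def] using c
    by (auto intro!: derivative_eq_intros simp: field_simps)
  moreover have "c powr (\<gamma> + 1) * c powr (- \<gamma> - 1) = 1"
    using c by (simp flip: powr_add)
  then have "\<gamma> * (\<gamma> * J powr (\<gamma> - 1)) * c powr (- \<gamma> - 1) = \<gamma>"
    unfolding sonic_speed_powr[symmetric] by (simp only: c_def mult.assoc mult_1_right)
  ultimately show ?thesis by (simp only: c_def add.commute)
qed

lemma bernoulli_smooth: "smooth_on {0<..} (bernoulli \<gamma> J)"
  unfolding bernoulli_def[abs_def] divide_inverse
  by (intro smooth_on_add smooth_on_mult smooth_on_power smooth_on_ident smooth_on_const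
      smooth_on_powr dense_in_itself_open open_greaterThan)

lemma bernoulli_unbounded_left: "\<exists>u. 0 < u \<and> u < sonic_speed \<gamma> J \<and> bernoulli \<gamma> J u \<ge> M"
proof -
  define A where "A = \<gamma> / (\<gamma> - 1) * J powr (\<gamma> - 1)"
  have A: "A > 0" using \<gamma> J by (simp add: A_def)
  \<comment> \<open>Here \<open>A * b = \<bar>M\<bar> + A\<close> exceeds \<open>M\<close>, and
    \<open>v\<close> solves \<open>v powr (1 - \<gamma>) = b\<close>. The minimum keeps
    \<open>u\<close> below the sonic speed and can only raise the power, whose exponent is
    negative.\<close>
  define b where "b = \<bar>M\<bar> / A + 1"
  define v where "v = b powr (1 / (1 - \<gamma>))"
  define u where "u = min (sonic_speed \<gamma> J / 2) v"
  have b: "b > 0" using A by (simp add: b_def add_nonneg_pos)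
  then have u: "0 < u" "u < sonic_speed \<gamma> J" "u \<le> v"
    using sonic_speed_pos by (auto simp: u_def v_def)
  have "b = v powr (1 - \<gamma>)" using b \<gamma> by (simp add: v_def powr_powr)
  also have "\<dots> \<le> u powr (1 - \<gamma>)" using u \<gamma> by (intro powr_mono2') auto
  finally have "A * b \<le> A * u powr (1 - \<gamma>)" using A by simp
  moreover have "M \<le> A * b" using A by (simp add: b_def distrib_left)
  ultimately have "M \<le> bernoulli \<gamma> J u"
    unfolding bernoulli_def A_def[symmetric] by (simp add: add_increasing)
  with u show ?thesis by blast
qed

lemma bernoulli_unbounded_right: "\<exists>u>sonic_speed \<gamma> J. bernoulli \<gamma> J u \<ge> M"
proof -
  \<comment> \<open>The summand \<open>2\<close> gives \<open>u^2 / 2 \<ge> u\<close>, and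
    \<open>u\<close> already exceeds \<open>M\<close>.\<close>
  define u where "u = sonic_speed \<gamma> J + 2 + \<bar>M\<bar>"
  have u: "u > sonic_speed \<gamma> J" "u \<ge> 2" "u \<ge> M"
    using sonic_speed_pos by (auto simp: u_def)
  have "M \<le> u * 2 / 2" using u by simp
  also have "\<dots> \<le> u * u / 2" using u by (intro divide_right_mono mult_left_mono) auto
  also have "\<dots> \<le> bernoulli \<gamma> J u"
    using \<gamma> by (simp add: bernoulli_def power2_eq_square)
  finally show ?thesis using u by blast
qed

lemma bernoulli_signed_root_chart:
  obtains \<Psi> \<psi> where "smooth_on UNIV \<Psi>" "smooth_on UNIV \<psi>" "\<And>s. \<Psi> s > 0" "\<And>s. \<psi> s > 0"
    "\<And>s. bernoulli \<gamma> J (\<Psi> s) = bernoulli \<gamma> J (sonic_speed \<gamma> J) + s\<^sup>2"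
    "\<And>s. \<Psi> s = sonic_speed \<gamma> J + s * \<psi> s" "\<psi> 0 = sqrt (2 / (\<gamma> + 1))"
    "strict_mono \<Psi>" "\<And>u. u > 0 \<Longrightarrow> \<exists>s. \<Psi> s = u"
proof (rule signed_root_chart[OF bernoulli_smooth sonic_speed_pos bernoulli_DERIV _ _ _
      bernoulli_deriv_DERIV_sonic _ bernoulli_unbounded_left bernoulli_unbounded_right])
  fix u assume u: "0 < u" "u < sonic_speed \<gamma> J"
  then have "u powr (\<gamma> + 1) < sonic_speed \<gamma> J powr (\<gamma> + 1)"
    using \<gamma> by (intro powr_less_mono2) auto
  then show "bernoulli_deriv \<gamma> J u < 0"
    using u by (simp add: bernoulli_deriv_eq mult_less_0_iff)
next
  fix u assume u: "sonic_speed \<gamma> J < u"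
  then have "sonic_speed \<gamma> J powr (\<gamma> + 1) < u powr (\<gamma> + 1)"
    using \<gamma> sonic_speed_pos by (intro powr_less_mono2) auto
  then show "bernoulli_deriv \<gamma> J u > 0"
    using u sonic_speed_pos by (simp add: bernoulli_deriv_eq)
next
  show "bernoulli_deriv \<gamma> J (sonic_speed \<gamma> J) = 0"
    using sonic_speed_pos by (simp add: bernoulli_deriv_eq)
qed (use \<gamma> in auto)

section \<open>Flow regimes and momentum balance at constant mass flux\<close>

lemma density_powr:
  assumes "u > 0" "\<rho> > 0" "\<rho> * u = J"
  shows "\<rho> powr (\<gamma> - 1) = J powr (\<gamma> - 1) * u powr (1 - \<gamma>)"
proof -
  have "J powr (\<gamma> - 1) = \<rho> powr (\<gamma> - 1) * u powr (\<gamma> - 1)"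
    unfolding assms(3)[symmetric] using assms(1,2) by (simp add: powr_mult)
  moreover have "u powr (\<gamma> - 1) * u powr (1 - \<gamma>) = 1"
    using assms(1) by (simp flip: powr_add)
  ultimately show ?thesis by (simp add: mult.assoc)
qed

text \<open>Both squares contain the positive factor \<open>u powr (1 - \<gamma>)\<close>; what
  remains is the comparison of the powers \<open>\<gamma> + 1\<close> of \<open>u\<close> and of the
  sonic speed.\<close>

lemma sound_speed_square_compare:
  assumes "u > 0" "\<rho> > 0" "\<rho> * u = J"
  shows "u\<^sup>2 < (sound_speed \<gamma> \<rho>)\<^sup>2 \<longleftrightarrow> u < sonic_speed \<gamma> J"
    and "(sound_speed \<gamma> \<rho>)\<^sup>2 < u\<^sup>2 \<longleftrightarrow> sonic_speed \<gamma> J < u"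
proof -
  define c where "c = sonic_speed \<gamma> J"
  have c: "c > 0" using sonic_speed_pos by (simp add: c_def)
  have "(sound_speed \<gamma> \<rho>)\<^sup>2 = c powr (\<gamma> + 1) * u powr (1 - \<gamma>)"
    using \<gamma> by (simp add: sound_speed_def c_def sonic_speed_powr density_powr[OF assms])
  moreover have "u\<^sup>2 = u powr (\<gamma> + 1) * u powr (1 - \<gamma>)"
    using assms(1) by (simp flip: powr_add)
  moreover have "u powr (\<gamma> + 1) < c powr (\<gamma> + 1) \<longleftrightarrow> u < c" "c powr (\<gamma> + 1) < u powr (\<gamma> + 1) \<longleftrightarrow> c < u"
    using assms(1) c \<gamma> powr_less_mono2[of "\<gamma> + 1" u c] powr_less_mono2[of "\<gamma> + 1" c u]
    by (cases u c rule: linorder_cases; force)+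
  ultimately show "u\<^sup>2 < (sound_speed \<gamma> \<rho>)\<^sup>2 \<longleftrightarrow> u < sonic_speed \<gamma> J"
    and "(sound_speed \<gamma> \<rho>)\<^sup>2 < u\<^sup>2 \<longleftrightarrow> sonic_speed \<gamma> J < u"
    using assms(1) by (simp_all add: c_def)
qed

lemma flow_regime_iff:
  assumes "u > 0" "\<rho> > 0" "\<rho> * u = J"
  shows "subsonic \<gamma> u \<rho> \<longleftrightarrow> u < sonic_speed \<gamma> J"
    and "sonic \<gamma> u \<rho> \<longleftrightarrow> u = sonic_speed \<gamma> J"
    and "supersonic \<gamma> u \<rho> \<longleftrightarrow> u > sonic_speed \<gamma> J"
  using assms sound_speed_square_compare[OF assms]
  unfolding subsonic_def sonic_def supersonic_def by (simp_all, linarith)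

lemma bernoulli_density:
  assumes "u > 0" "\<rho> > 0" "\<rho> * u = J"
  shows "bernoulli \<gamma> J u = u\<^sup>2 / 2 + \<gamma> / (\<gamma> - 1) * \<rho> powr (\<gamma> - 1)"
  by (simp add: bernoulli_def density_powr[OF assms])

text \<open>At constant flux the momentum expression is \<open>\<rho>\<close> times the derivative
  of the Bernoulli function along \<open>u\<close>. The identity serves both directions between the
  momentum equation and Bernoulli's law.\<close>

lemma momentum_eq_bernoulli_deriv:
  assumes S: "dense_in_itself S" "x \<in> S"
    and flux: "\<And>t. t \<in> S \<Longrightarrow> \<rho> t > 0 \<and> u t > 0 \<and> \<rho> t * u t = J"
    and u': "(u has_real_derivative u') (at x within S)"
  shows "\<rho> x * u x * deriv_within S u x + deriv_within S (\<lambda>t. pressure \<gamma> (\<rho> t)) x =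
    \<rho> x * (bernoulli_deriv \<gamma> J (u x) * u')"
proof -
  have x: "\<rho> x > 0" "u x > 0" "\<rho> x * u x = J" using flux[OF S(2)] by auto
  \<comment> \<open>The pressure is differentiated as a function of \<open>u\<close>, so only a
    derivative of \<open>u\<close> enters.\<close>
  have "((\<lambda>t. (J / u t) powr \<gamma>) has_real_derivative
      \<gamma> * (J / u x) powr (\<gamma> - 1) * (- J * u' / (u x * u x))) (at x within S)"
  proof -
    have "((\<lambda>t. J / u t) has_real_derivative - J * u' / (u x * u x)) (at x within S)"
      using u' x by (auto intro!: derivative_eq_intros)
    moreover have "((\<lambda>z. z powr \<gamma>) has_real_derivative \<gamma> * (J / u x) powr (\<gamma> - 1)) (at (J / u x))"
      using x J by (intro has_real_derivative_powr) simp
    ultimately show ?thesis by (rule DERIV_chain2[rotated])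
  qed
  then have "((\<lambda>t. pressure \<gamma> (\<rho> t)) has_real_derivative
      \<gamma> * (J / u x) powr (\<gamma> - 1) * (- J * u' / (u x * u x))) (at x within S)"
  proof (rule has_real_derivative_cong_on[rotated 2])
    fix t assume "t \<in> S"
    then have "J / u t = \<rho> t" using flux[of t] by (simp add: field_simps)
    then show "(J / u t) powr \<gamma> = pressure \<gamma> (\<rho> t)" by (simp add: pressure_def)
  qed (rule S(2))
  moreover have "J / u x = \<rho> x" "- J * u' / (u x * u x) = - (\<rho> x * u' / u x)"
    using x by (auto simp: field_simps)
  ultimately have
    "deriv_within S (\<lambda>t. pressure \<gamma> (\<rho> t)) x = - (\<rho> x * (\<gamma> * \<rho> x powr (\<gamma> - 1) / u x * u'))"
    using deriv_within_eq[OF S] by (simp only: mult_minus_right mult_minus_left) (simp only: mult_ac times_divide_eq_right times_divide_eq_left)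
  moreover have "\<gamma> * J powr (\<gamma> - 1) * u x powr (- \<gamma>) = \<gamma> * \<rho> x powr (\<gamma> - 1) / u x"
    using x(2) powr_mult_base[of "u x" "- \<gamma>"] by (simp add: density_powr[OF x(2,1,3)] field_simps)
  ultimately show ?thesis
    by (simp add: bernoulli_deriv_def deriv_within_eq[OF S u'] algebra_simps)
qed

end

section \<open>Smooth flows\<close>

lemma smooth_solution_flux:
  assumes S: "a < b" and sol: "smooth_solution \<gamma> a b \<rho>0 u0 f \<rho> u"
    and x: "x \<in> {a..b}"
  shows "\<rho> x * u x = \<rho>0 * u0"
proof -
  have d: "dense_in_itself {a..b}" using S by (rule dense_in_itself_Icc)
  have "smooth_on {a..b} (\<lambda>t. \<rho> t * u t)"
    using sol d by (intro smooth_on_mult) (auto simp: smooth_solution_def)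
  then have "((\<lambda>t. \<rho> t * u t) has_real_derivative 0) (at t within {a..b})" if "t \<in> {a..b}" for t
    using smooth_on_DERIV[of "{a..b}" "\<lambda>t. \<rho> t * u t" t] that sol by (auto simp: smooth_solution_def)
  then obtain k where "\<And>t. t \<in> {a..b} \<Longrightarrow> \<rho> t * u t = k"
    using has_field_derivative_zero_constant[of "{a..b}" "\<lambda>t. \<rho> t * u t"] by blast
  then show ?thesis
    using x S sol by (metis atLeastAtMost_iff order_less_imp_le order_refl smooth_solution_def)
qed

text \<open>The difference of the Bernoulli function along \<open>u\<close> and the integral of
  \<open>f\<close> has derivative \<open>0\<close>; the constant is read off at \<open>a\<close>,
  where the integral vanishes and \<open>u a = u0\<close>.\<close>

lemma smooth_solution_bernoulli:
  assumes \<gamma>: "\<gamma> > 1" and pos: "\<rho>0 > 0" "u0 > 0" and S: "a < b"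
    and f: "continuous_on {a..b} f" and sol: "smooth_solution \<gamma> a b \<rho>0 u0 f \<rho> u"
    and x: "x \<in> {a..b}"
  shows "u x > 0" "bernoulli \<gamma> (\<rho>0 * u0) (u x) = bernoulli \<gamma> (\<rho>0 * u0) u0 + integral {a..x} f"
proof -
  define J where "J = \<rho>0 * u0"
  have J: "J > 0" using pos by (simp add: J_def)
  have d: "dense_in_itself {a..b}" using S by (rule dense_in_itself_Icc)
  have flux: "\<rho> t > 0 \<and> u t > 0 \<and> \<rho> t * u t = J" if "t \<in> {a..b}" for t
  proof -
    have "\<rho> t > 0" using sol that by (simp add: smooth_solution_def)
    moreover have "\<rho> t * u t = J"
      unfolding J_def using S sol that by (rule smooth_solution_flux)
    ultimately show ?thesis
      using J by (metis zero_less_mult_pos)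
  qed
  show "u x > 0" using flux[OF x] by simp
  have "((\<lambda>t. bernoulli \<gamma> J (u t) - integral {a..t} f) has_real_derivative 0) (at t within {a..b})"
    if t: "t \<in> {a..b}" for t
  proof -
    have u': "(u has_real_derivative deriv_within {a..b} u t) (at t within {a..b})"
      using sol t by (intro smooth_on_DERIV) (auto simp: smooth_solution_def)
    have "\<rho> t * (bernoulli_deriv \<gamma> J (u t) * deriv_within {a..b} u t) = \<rho> t * f t"
      using momentum_eq_bernoulli_deriv[OF \<gamma> J d t flux u'] sol t by (auto simp: smooth_solution_def)
    then have "bernoulli_deriv \<gamma> J (u t) * deriv_within {a..b} u t = f t"
      using flux[OF t] by simp
    then have "((\<lambda>t. bernoulli \<gamma> J (u t)) has_real_derivative f t) (at t within {a..b})"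
      using DERIV_chain2[OF bernoulli_DERIV[OF \<gamma> J] u'] flux[OF t] by simp
    from DERIV_diff[OF this integral_has_real_derivative[OF f t]] show ?thesis by simp
  qed
  then obtain k where "\<And>t. t \<in> {a..b} \<Longrightarrow> bernoulli \<gamma> J (u t) - integral {a..t} f = k"
    using has_field_derivative_zero_constant[of "{a..b}" "\<lambda>t. bernoulli \<gamma> J (u t) - integral {a..t} f"]
    by blast
  from this[OF x] this[of a] show "bernoulli \<gamma> (\<rho>0 * u0) (u x) = bernoulli \<gamma> (\<rho>0 * u0) u0 + integral {a..x} f"
    using S sol by (simp add: smooth_solution_def J_def)
qed

text \<open>Converse of the preceding integration. Two derivatives of the same function are equated,
  without dividing by \<open>bernoulli_deriv\<close>, so its zero at a sonic point does no
  harm.\<close>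

lemma smooth_solutionI:
  assumes \<gamma>: "\<gamma> > 1" and J: "J > 0" and S: "a < b"
    and u: "smooth_on {a..b} u" "\<And>x. x \<in> {a..b} \<Longrightarrow> u x > 0" "u a = u0" "\<rho>0 * u0 = J"
    and f: "continuous_on {a..b} f"
    and bernoulli: "\<And>x. x \<in> {a..b} \<Longrightarrow> bernoulli \<gamma> J (u x) = k + integral {a..x} f"
  shows "smooth_solution \<gamma> a b \<rho>0 u0 f (\<lambda>x. J / u x) u"
proof -
  have d: "dense_in_itself {a..b}" using S by (rule dense_in_itself_Icc)
  have flux: "J / u t > 0 \<and> u t > 0 \<and> J / u t * u t = J" if "t \<in> {a..b}" for t
    using u(2)[OF that] J by simp
  have \<rho>: "smooth_on {a..b} (\<lambda>x. J / u x)"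
    unfolding divide_inverse using d u(1,2)
    by (intro smooth_on_mult smooth_on_const smooth_on_inverse)
  have mass: "deriv_within {a..b} (\<lambda>t. J / u t * u t) x = 0" if "x \<in> {a..b}" for x
    using d that
    by (rule deriv_within_eq)
      (rule has_real_derivative_cong_on[of _ "\<lambda>_. J"], use flux that in auto)
  have momentum: "J / u x * u x * deriv_within {a..b} u x + deriv_within {a..b} (\<lambda>t. pressure \<gamma> (J / u t)) x
      = J / u x * f x" if x: "x \<in> {a..b}" for x
  proof -
    have u': "(u has_real_derivative deriv_within {a..b} u x) (at x within {a..b})"
      using u(1) x by (rule smooth_on_DERIV)
    have "((\<lambda>x. k + integral {a..x} f) has_real_derivative f x) (at x within {a..b})"
      using DERIV_add[OF DERIV_const[of k] integral_has_real_derivative[OF f x]] by simp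
    then have "((\<lambda>x. bernoulli \<gamma> J (u x)) has_real_derivative f x) (at x within {a..b})"
      by (rule has_real_derivative_cong_on[rotated 2]) (use bernoulli x in auto)
    moreover have "((\<lambda>x. bernoulli \<gamma> J (u x)) has_real_derivative
        bernoulli_deriv \<gamma> J (u x) * deriv_within {a..b} u x) (at x within {a..b})"
      using DERIV_chain2[OF bernoulli_DERIV[OF \<gamma> J u(2)[OF x]] u'] .
    ultimately have "bernoulli_deriv \<gamma> J (u x) * deriv_within {a..b} u x = f x"
      using deriv_within_eq[OF d x] by metis
    then show ?thesis
      using momentum_eq_bernoulli_deriv[OF \<gamma> J d x flux u'] by simp
  qed
  have "J / u a = \<rho>0" using u(2)[of a] u(3,4) S by (simp add: field_simps)
  then show ?thesis
    unfolding smooth_solution_def using \<rho> u(1,3) flux mass momentum by blast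
qed

section \<open>Existence, uniqueness and expansion at the sonic point\<close>

theorem proposition1p4:
  fixes \<gamma> L0 L1 \<rho>0 u0 J B0 :: real and f :: "real \<Rightarrow> real" and m :: nat
  assumes "\<gamma> > 1" and "L0 < 0" and "0 < L1" and "\<rho>0 > 0" and "u0 > 0"
    and "J = \<rho>0 * u0"
    and "B0 = u0\<^sup>2 / 2 + \<gamma> / (\<gamma> - 1) * \<rho>0 powr (\<gamma> - 1)"
    and "subsonic \<gamma> u0 \<rho>0"
    and "smooth_on {L0..L1} f"
    and "\<forall>x\<in>{L0..<0}. f x < 0" and "f 0 = 0" and "\<forall>x\<in>{0<..L1}. f x > 0"
    and "integral {L0..0} f =
           (\<gamma> + 1) / (2 * (\<gamma> - 1)) * \<gamma> powr (2 / (\<gamma> + 1)) * J powr (2 * (\<gamma> - 1) / (\<gamma> + 1)) - B0"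
    and "\<forall>k\<in>{1..4 * m}. nth_deriv_within {L0..L1} k f 0 = 0"
    and "nth_deriv_within {L0..L1} (4 * m + 1) f 0 > 0"
  shows "\<exists>\<rho> u.
      smooth_solution \<gamma> L0 L1 \<rho>0 u0 f \<rho> u \<and> accelerating_transonic \<gamma> L0 L1 \<rho> u \<and>
      (\<forall>\<rho>' u'. smooth_solution \<gamma> L0 L1 \<rho>0 u0 f \<rho>' u' \<and> accelerating_transonic \<gamma> L0 L1 \<rho>' u'
          \<longrightarrow> (\<forall>x\<in>{L0..L1}. \<rho>' x = \<rho> x \<and> u' x = u x)) \<and>
      (\<forall>x\<in>{L0..<0}. subsonic \<gamma> (u x) (\<rho> x)) \<and>
      sonic \<gamma> (u 0) (\<rho> 0) \<and>
      (\<forall>x\<in>{0<..L1}. supersonic \<gamma> (u x) (\<rho> x)) \<and>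
      (\<exists>y. smooth_on {L0..L1} y \<and> (\<forall>x\<in>{L0..L1}. y x > 0) \<and>
         (\<forall>x\<in>{L0..L1}. u x = sonic_speed \<gamma> J + x ^ (2 * m + 1) * y x) \<and>
         (\<forall>k\<in>{1..2 * m}. nth_deriv_within {L0..L1} k u 0 = 0) \<and>
         nth_deriv_within {L0..L1} (2 * m + 1) u 0 = fact (2 * m + 1) * y 0 \<and>
         fact (2 * m + 1) * y 0 =
           fact (2 * m + 1) * sqrt (2 * nth_deriv_within {L0..L1} (4 * m + 1) f 0
                                    / ((\<gamma> + 1) * fact (4 * m + 2))) \<and>
         fact (2 * m + 1) * sqrt (2 * nth_deriv_within {L0..L1} (4 * m + 1) f 0
                                    / ((\<gamma> + 1) * fact (4 * m + 2))) > 0)"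
proof -
  note a = assms
  define S where "S = {L0..L1}"
  define c where "c = sonic_speed \<gamma> J"
  define H where "H = bernoulli \<gamma> J"
  have J: "J > 0" using a(4-6) by simp
  have S: "dense_in_itself S" "0 \<in> S" "L0 \<in> S" "L1 \<in> S"
    using a(2,3) by (auto simp: S_def dense_in_itself_Icc)
  have L: "L0 < L1" using a(2,3) by simp
  have f_cont: "continuous_on {L0..L1} f" using a(9) by (rule smooth_on_imp_continuous_on)
  obtain w where w: "smooth_on S w" "\<And>x. x \<in> S \<Longrightarrow> w x > 0"
    "\<And>x. x \<in> S \<Longrightarrow> (x ^ (2 * m + 1) * w x)\<^sup>2 = integral {L0..x} f - integral {L0..0} f"
    "w 0 = sqrt (nth_deriv_within S (4 * m + 1) f 0 / fact (4 * m + 2))"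
    "strict_mono_on S (\<lambda>x. x ^ (2 * m + 1) * w x)"
    using signed_root_of_primitive[of L0 L1 f m] a(2,3,9-12,14,15) unfolding S_def by (auto simp del: fact_Suc)
  obtain \<Psi> \<psi> where \<Psi>: "smooth_on UNIV \<Psi>" "smooth_on UNIV \<psi>" "\<And>s. \<Psi> s > 0" "\<And>s. \<psi> s > 0"
    "\<And>s. H (\<Psi> s) = H c + s\<^sup>2" "\<And>s. \<Psi> s = c + s * \<psi> s" "\<psi> 0 = sqrt (2 / (\<gamma> + 1))"
    "strict_mono \<Psi>" "\<And>u. u > 0 \<Longrightarrow> \<exists>s. \<Psi> s = u"
    using bernoulli_signed_root_chart[OF a(1) J] unfolding H_def c_def by blast
  define g where "g x = x ^ (2 * m + 1) * w x" for x
  define u where "u x = \<Psi> (g x)" for x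
  \<comment> \<open>From \<open>\<Psi> s = c + s * \<psi> s\<close> at \<open>s = g x\<close>, with
    the power of \<open>x\<close> taken out of \<open>g\<close>.\<close>
  define y where "y x = w x * \<psi> (g x)" for x
  have g: "smooth_on S g"
    unfolding g_def[abs_def] using S(1) w(1) by (intro smooth_on_mult smooth_on_power smooth_on_ident)
  have g0: "g 0 = 0" by (simp add: g_def)
  have g_mono: "g x < g z" if "x \<in> S" "z \<in> S" "x < z" for x z
    using strict_mono_onD[OF w(5)] that by (simp add: g_def)
  have c_less: "c < \<Psi> s \<longleftrightarrow> 0 < s" and less_c: "\<Psi> s < c \<longleftrightarrow> s < 0" for s
    using \<Psi>(4)[of s] by (auto simp: \<Psi>(6)[of s] zero_less_mult_iff mult_less_0_iff)
  have Bern0: "H u0 + integral {L0..0} f = H c"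
    using bernoulli_sonic[OF a(1) J] bernoulli_density[OF a(1) J a(5,4)] a(6,7,13) by (simp add: H_def c_def)
  then have bern: "H u0 + integral {L0..x} f = H c + (g x)\<^sup>2" if "x \<in> S" for x
    using w(3)[OF that] by (simp add: g_def)
  \<comment> \<open>Bernoulli's law at \<open>L0\<close> fixes the parameter of \<open>u0\<close>
    only up to sign; subsonic data make it negative, as is \<open>g L0\<close>.\<close>
  have "u L0 = u0"
  proof -
    obtain s where s: "\<Psi> s = u0" using \<Psi>(9)[OF a(5)] by blast
    have "u0 < c" using flow_regime_iff(1)[OF a(1) J a(5,4)] a(6,8) by (simp add: c_def)
    then have "s < 0" using less_c[of s] s by simp
    moreover have "g L0 < 0" using g_mono[OF S(3,2) a(2)] g0 by simp
    moreover have "s\<^sup>2 = (g L0)\<^sup>2" using bern[OF S(3)] \<Psi>(5)[of s] s by simp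
    ultimately have "s = g L0" by (simp add: power2_eq_iff)
    then show ?thesis using s by (simp add: u_def)
  qed
  moreover have u_smooth: "smooth_on S u"
    unfolding u_def[abs_def] by (rule smooth_on_compose[OF S(1) _ \<Psi>(1) g]) (auto simp: dense_in_itself_open)
  moreover have u_pos: "u x > 0" for x using \<Psi>(3) by (simp add: u_def)
  moreover have "H (u x) = H u0 + integral {L0..x} f" if "x \<in> S" for x
    using bern[OF that] \<Psi>(5) by (simp add: u_def)
  ultimately have sol: "smooth_solution \<gamma> L0 L1 \<rho>0 u0 f (\<lambda>x. J / u x) u"
    using a(6) L f_cont by (intro smooth_solutionI[OF a(1) J, where k = "H u0"]) (auto simp: S_def H_def)
  have u_mono: "strict_mono_on S u"
    using g_mono strict_monoD[OF \<Psi>(8)] by (intro strict_mono_onI) (simp add: u_def)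
  have flux: "J / u x > 0" "J / u x * u x = J" for x
    using J u_pos[of x] by auto
  note regime = flow_regime_iff[OF a(1) J u_pos flux, folded c_def]
  have sub: "subsonic \<gamma> (u x) (J / u x)" if "x \<in> {L0..<0}" for x
    unfolding regime unfolding u_def less_c using g_mono[of x 0] that S g0 a(3) by (simp add: S_def)
  have super: "supersonic \<gamma> (u x) (J / u x)" if "x \<in> {0<..L1}" for x
    unfolding regime unfolding u_def c_less using g_mono[of 0 x] that S g0 a(2) by (simp add: S_def)
  have son: "sonic \<gamma> (u 0) (J / u 0)"
    unfolding regime unfolding u_def g0 using \<Psi>(6)[of 0] by simp
  have trans: "accelerating_transonic \<gamma> L0 L1 (\<lambda>x. J / u x) u"
    unfolding accelerating_transonic_def
    using u_mono sub[of L0] super[of L1] a(2,3) S(3,4) unfolding S_def by auto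
  have uniq: "\<rho>' x = J / u x \<and> u' x = u x"
    if sol': "smooth_solution \<gamma> L0 L1 \<rho>0 u0 f \<rho>' u'"
      and trans': "accelerating_transonic \<gamma> L0 L1 \<rho>' u'" and x: "x \<in> S" for \<rho>' u' x
  proof -
    have u': "u' t > 0" "H (u' t) = H c + (g t)\<^sup>2" if "t \<in> S" for t
      using smooth_solution_bernoulli[OF a(1,4,5) L f_cont sol'] that bern[OF that] a(6)
      unfolding S_def H_def by auto
    \<comment> \<open>A competitor is pulled back through the chart. Its parameter \<open>s\<close>
      equals \<open>g\<close> up to sign at each point.\<close>
    then have "\<forall>t\<in>S. \<exists>s. \<Psi> s = u' t" using \<Psi>(9) by blast
    then obtain s where s: "\<And>t. t \<in> S \<Longrightarrow> \<Psi> (s t) = u' t" by metis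
    have sq: "(s t)\<^sup>2 = (g t)\<^sup>2" if "t \<in> S" for t
      using u'(2)[OF that] \<Psi>(5)[of "s t"] s[OF that] by simp
    have s_mono: "s t < s t'" if "t \<in> S" "t' \<in> S" "t < t'" for t t'
      using trans' that strict_mono_less[OF \<Psi>(8)] s
      unfolding accelerating_transonic_def S_def by (metis strict_mono_onD)
    \<comment> \<open>The vanishing of \<open>g\<close> at \<open>0\<close> makes every competitor
      sonic there; strict monotonicity of \<open>s\<close> then gives it the sign of
      \<open>x\<close>, which is the sign of \<open>g x\<close>.\<close>
    have s0: "s 0 = 0" using sq[OF S(2)] g0 by simp
    have "s x = g x"
    proof (cases x "0::real" rule: linorder_cases)
      case less
      then show ?thesis using s_mono[OF x S(2)] g_mono[OF x S(2)] s0 g0 sq[OF x] by (auto simp: power2_eq_iff)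
    next
      case equal
      then show ?thesis by (simp add: s0 g0)
    next
      case greater
      then show ?thesis using s_mono[OF S(2) x] g_mono[OF S(2) x] s0 g0 sq[OF x] by (auto simp: power2_eq_iff)
    qed
    then have "u' x = u x" using s[OF x] by (simp add: u_def)
    moreover have "\<rho>' x * u' x = J"
      using smooth_solution_flux[OF L sol'] x a(6) by (simp add: S_def)
    ultimately show ?thesis using u_pos[of x] by (simp add: field_simps)
  qed
  have y_smooth: "smooth_on S y"
    unfolding y_def[abs_def] using S(1) w(1)
    by (intro smooth_on_mult smooth_on_compose[OF S(1) _ \<Psi>(2) g]) (auto simp: dense_in_itself_open)
  have y_pos: "y x > 0" if "x \<in> S" for x
    using w(2)[OF that] \<Psi>(4) by (simp add: y_def)
  have u_eq: "u x = c + x ^ (2 * m + 1) * y x" for x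
    using \<Psi>(6)[of "g x"] by (simp add: u_def y_def g_def mult.assoc)
  \<comment> \<open>Positive order removes the constant \<open>c\<close>, leaving the derivatives of
    \<open>x ^ (2 * m + 1) * y x\<close> at \<open>0\<close>.\<close>
  have deriv: "nth_deriv_within S k u 0 = (if k = 2 * m + 1 then fact (2 * m + 1) * y 0 else 0)"
    if k: "0 < k" "k \<le> 2 * m + 1" for k
  proof -
    obtain j where j: "k = Suc j" using k(1) by (cases k) auto
    let ?p = "\<lambda>x. (x - 0) ^ (2 * m + 1) * y x"
    have p: "smooth_on S ?p"
      using S(1) y_smooth by (intro smooth_on_mult smooth_on_power smooth_on_diff smooth_on_ident smooth_on_const)
    have "deriv_within S u x = deriv_within S ?p x" if "x \<in> S" for x
    proof (rule deriv_within_eq[OF S(1) that])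
      show "(u has_real_derivative deriv_within S ?p x) (at x within S)"
        using DERIV_add[OF DERIV_const[of c] smooth_on_DERIV[OF p that]] by (simp add: u_eq[abs_def])
    qed
    then have "nth_deriv_within S k u 0 = nth_deriv_within S k ?p 0"
      unfolding j nth_deriv_within_Suc
      by (rule nth_deriv_within_cong[OF S(1) _ smooth_on_deriv_within[OF u_smooth] S(2)])
    also have "\<dots> = (if k = 2 * m + 1 then fact (2 * m + 1) * y 0 else 0)"
      using S(1,2) y_smooth k(2) by (rule nth_deriv_within_power_mult)
    finally show ?thesis .
  qed
  \<comment> \<open>The two roots \<open>w 0\<close>, from the force, and \<open>\<psi> 0\<close>,
    from the curvature of the Bernoulli function, multiply to the stated constant.\<close>
  have y0: "y 0 = sqrt (2 * nth_deriv_within S (4 * m + 1) f 0 / ((\<gamma> + 1) * fact (4 * m + 2)))"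
    by (simp only: y_def g0 w(4) \<Psi>(7) real_sqrt_mult[symmetric] times_divide_times_eq mult.commute)
  have repr: "\<exists>y. smooth_on S y \<and> (\<forall>x\<in>S. y x > 0) \<and>
         (\<forall>x\<in>S. u x = c + x ^ (2 * m + 1) * y x) \<and>
         (\<forall>k\<in>{1..2 * m}. nth_deriv_within S k u 0 = 0) \<and>
         nth_deriv_within S (2 * m + 1) u 0 = fact (2 * m + 1) * y 0 \<and>
         fact (2 * m + 1) * y 0 =
           fact (2 * m + 1) * sqrt (2 * nth_deriv_within S (4 * m + 1) f 0
                                    / ((\<gamma> + 1) * fact (4 * m + 2))) \<and>
         fact (2 * m + 1) * sqrt (2 * nth_deriv_within S (4 * m + 1) f 0
                                    / ((\<gamma> + 1) * fact (4 * m + 2))) > 0"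
    unfolding y0[symmetric] using y_smooth y_pos u_eq deriv S(2)
    by (intro exI[of _ y] conjI ballI) (auto simp del: fact_Suc power_Suc)
  show ?thesis
    unfolding S_def[symmetric] c_def[symmetric]
  proof (rule exI[of _ "\<lambda>x. J / u x"], rule exI[of _ u], intro conjI)
    show "\<forall>\<rho>' u'. smooth_solution \<gamma> L0 L1 \<rho>0 u0 f \<rho>' u' \<and> accelerating_transonic \<gamma> L0 L1 \<rho>' u'
        \<longrightarrow> (\<forall>x\<in>S. \<rho>' x = J / u x \<and> u' x = u x)"
      using uniq by blast
  qed (use sol trans sub super son in \<open>blast intro: repr\<close>)+
qed

end
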